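(* For the numerical solution of the scheme (SAV), given in the context, the following estimate holds: $$\|\phi_S^m\|_{H^3(\Omega)}\le Q^{(3)}\qquad\text{for all } m\ge1,$$ where $\phi_S^m$ is the spectral interpolation of $\phi^m$. The constant $Q^{(3)}$ depends only on the initial $H^3$ data (i.e. on bounds for $\|\phi_S^0\|_{H^3}$ and $\|\phi_S^{-1}\|_{H^3}$) and on the domain (and the fixed parameter $a$), and is independent of $\Delta t$, $h$ and the final time $T$.
   Context: Let $\Omega=(0,1)^3$ ($|\Omega|=1$), $N=2K+1$ with $K\in\mathbb N$, $h=1/N$, grid points $(x_i,y_j,z_k)=(ih,jh,kh)$; $\Delta t>0$. $\mathcal G_N$ is the space of real grid functions $f:\mathbb Z^3\to\mathbb R$ that are $N$-periodic in each index. For $f,g\in\mathcal G_N$: $\langle f,g\rangle=h^3\sum_{i,j,k=0}^{N-1}f_{i,j,k}g_{i,j,k}$, $\|f\|_p=(h^3\sum_{i,j,k=0}^{N-1}|f_{i,j,k}|^p)^{1/p}$ (for vector-valued grid functions $|\cdot|$ is the Euclidean norm). Every $f\in\mathcal G_N$ has the discrete Fourier expansion $f_{i,j,k}=\sum_{\ell,m,n=-K}^K\hat f^N_{\ell,m,n}e^{2\pi\mathrm i(\ell x_i+my_j+nz_k)}$; its spectral interpolation is the trigonometric polynomial $f_S(x,y,z)=\sum_{\ell,m,n=-K}^K\hat f^N_{\ell,m,n}e^{2\pi\mathrm i(\ell x+my+nz)}$. The Fourier pseudo-spectral derivative $\mathcal D_x$ multiplies $\hat f^N_{\ell,m,n}$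 by $2\pi\mathrm i\ell$ (similarly $\mathcal D_y,\mathcal D_z$ with $m,n$); $\nabla_N f=(\mathcal D_xf,\mathcal D_yf,\mathcal D_zf)^T$, $\nabla_N\cdot(f_1,f_2,f_3)^T=\mathcal D_xf_1+\mathcal D_yf_2+\mathcal D_zf_3$, $\Delta_N=\nabla_N\cdot\nabla_N$. The constant $a=1-\varepsilon$, $0<\varepsilon<1$, is a fixed parameter, so $0<a<1$. Define $N_N(\phi)=-\nabla_N\cdot(|\nabla_N\phi|^2\nabla_N\phi)+2\Delta_N\phi$ (pointwise products), $L_N\phi=a\phi+\Delta_N^2\phi$, and $E_{1,N}(\phi)=\frac14\|\nabla_N\phi\|_4^4-\|\nabla_N\phi\|_2^2+2|\Omega|$. Scheme (SAV): given $\phi^n,\phi^{n-1}\in\mathcal G_N$ and $r^n,r^{n-1}\in\mathbb R$, with $\hat\phi^{n+1}=2\phi^n-\phi^{n-1}$, find $\phi^{n+1}\in\mathcal G_N$, $r^{n+1}\in\mathbb R$ such that $$\frac{\frac32\phi^{n+1}-2\phi^n+\frac12\phi^{n-1}}{\Delta t}=\Delta_N\Big(\frac{r^{n+1}}{\sqrt{E_{1,N}(\hat\phi^{n+1})}}N_N(\hat\phi^{n+1})+L_N\phi^{n+1}\Big),$$ $$\frac{\frac32r^{n+1}-2r^n+\frac12r^{n-1}}{\Delta t}=\frac{1}{2\sqrt{E_{1,N}(\hat\phi^{n+1})}}\Big\langle N_N(\hat\phi^{n+1}),\frac{\frac32\phi^{n+1}-2\phi^n+\frac12\phi^{n-1}}{\Delta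 t}\Big\rangle,$$ for $n\ge0$, started from $\phi^0\in\mathcal G_N$, $\phi^{-1}=\phi^0-\Delta t\,\Delta_N\mu^0$ with $\mu^0=-\nabla_N\cdot(|\nabla_N\phi^0|^2\nabla_N\phi^0)+a\phi^0+2\Delta_N\phi^0+\Delta_N^2\phi^0$, $r^0=\sqrt{E_{1,N}(\phi^0)}$, $r^{-1}=\sqrt{E_{1,N}(\phi^{-1})}$. *)

theory Defs
  imports "HOL-Analysis.Analysis"
begin

section \<open>Grid functions\<close>

text \<open>
  Nodes and wave vectors are both integer triples. The number of nodes per direction is
  \<open>N = 2 * K + 1\<close>. Everything is parametrised by \<open>K\<close>.
\<close>

type_synonym index = "int \<times> int \<times> int"

definition num_pts :: "nat \<Rightarrow> int" where
  "num_pts K = 2 * int K + 1"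

definition mesh :: "nat \<Rightarrow> real" where
  "mesh K = 1 / real_of_int (num_pts K)"

definition nodes :: "nat \<Rightarrow> index set" where
  "nodes K = {0..num_pts K - 1} \<times> {0..num_pts K - 1} \<times> {0..num_pts K - 1}"

definition freqs :: "nat \<Rightarrow> index set" where
  "freqs K = {- int K..int K} \<times> {- int K..int K} \<times> {- int K..int K}"

definition grid_point :: "nat \<Rightarrow> index \<Rightarrow> real ^ 3" where
  "grid_point K = (\<lambda>(i, j, k). vector [of_int i * mesh K, of_int j * mesh K, of_int k * mesh K])"

definition grid_space :: "nat \<Rightarrow> (index \<Rightarrow> real) set" where
  "grid_space K = {f. \<forall>i j k.
     f (i + num_pts K, j, k) = f (i, j, k) \<and>
     f (i, j + num_pts K, k) = f (i, j, k) \<and>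
     f (i, j, k + num_pts K) = f (i, j, k)}"

definition grid_inner :: "nat \<Rightarrow> (index \<Rightarrow> real) \<Rightarrow> (index \<Rightarrow> real) \<Rightarrow> real" where
  "grid_inner K f g = mesh K ^ 3 * (\<Sum>p\<in>nodes K. f p * g p)"

definition grid_norm :: "nat \<Rightarrow> real \<Rightarrow> (index \<Rightarrow> 'v::real_normed_vector) \<Rightarrow> real" where
  "grid_norm K q f = (mesh K ^ 3 * (\<Sum>p\<in>nodes K. norm (f p) powr q)) powr (1 / q)"


section \<open>Discrete Fourier expansion and spectral interpolation\<close>

definition wave :: "index \<Rightarrow> real ^ 3 \<Rightarrow> complex" where
  "wave = (\<lambda>(l, m, n) x.
     exp (2 * of_real pi * \<i> * of_real (of_int l * x $ 1 + of_int m * x $ 2 + of_int n * x $ 3)))"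

text \<open>
  The coefficients are given by the inversion formula. That they are exactly the coefficients
  of the discrete Fourier expansion is proved below (\<open>dft_expansion\<close>, \<open>dft_unique\<close>).
\<close>

definition dft :: "nat \<Rightarrow> (index \<Rightarrow> real) \<Rightarrow> index \<Rightarrow> complex" where
  "dft K f \<kappa> = of_real (mesh K ^ 3) *
     (\<Sum>p\<in>nodes K. of_real (f p) * cnj (wave \<kappa> (grid_point K p)))"

definition spectral_interp :: "nat \<Rightarrow> (index \<Rightarrow> real) \<Rightarrow> real ^ 3 \<Rightarrow> complex" where
  "spectral_interp K f x = (\<Sum>\<kappa>\<in>freqs K. dft K f \<kappa> * wave \<kappa> x)"


section \<open>Pseudo-spectral differential operators\<close>

text \<open>
  The real part only fixes the type: for the symbols used here the sum is real, because
  \<open>freqs K\<close> is symmetric and the grid function is real (\<open>of_real_D\<close> below).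
\<close>

definition fourier_multiplier ::
    "nat \<Rightarrow> (index \<Rightarrow> complex) \<Rightarrow> (index \<Rightarrow> real) \<Rightarrow> index \<Rightarrow> real" where
  "fourier_multiplier K \<sigma> f p =
     Re (\<Sum>\<kappa>\<in>freqs K. \<sigma> \<kappa> * dft K f \<kappa> * wave \<kappa> (grid_point K p))"

definition Dx :: "nat \<Rightarrow> (index \<Rightarrow> real) \<Rightarrow> index \<Rightarrow> real" where
  "Dx K = fourier_multiplier K (\<lambda>(l, m, n). 2 * of_real pi * \<i> * of_int l)"

definition Dy :: "nat \<Rightarrow> (index \<Rightarrow> real) \<Rightarrow> index \<Rightarrow> real" where
  "Dy K = fourier_multiplier K (\<lambda>(l, m, n). 2 * of_real pi * \<i> * of_int m)"

definition Dz :: "nat \<Rightarrow> (index \<Rightarrow> real) \<Rightarrow> index \<Rightarrow> real" where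
  "Dz K = fourier_multiplier K (\<lambda>(l, m, n). 2 * of_real pi * \<i> * of_int n)"

definition grad_N :: "nat \<Rightarrow> (index \<Rightarrow> real) \<Rightarrow> index \<Rightarrow> real ^ 3" where
  "grad_N K f p = vector [Dx K f p, Dy K f p, Dz K f p]"

definition div_N :: "nat \<Rightarrow> (index \<Rightarrow> real ^ 3) \<Rightarrow> index \<Rightarrow> real" where
  "div_N K F p = Dx K (\<lambda>q. F q $ 1) p + Dy K (\<lambda>q. F q $ 2) p + Dz K (\<lambda>q. F q $ 3) p"

definition laplace_N :: "nat \<Rightarrow> (index \<Rightarrow> real) \<Rightarrow> index \<Rightarrow> real" where
  "laplace_N K f = div_N K (grad_N K f)"


section \<open>The Sobolev norm on the unit cube\<close>

definition unit_cube :: "(real ^ 3) set" where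
  "unit_cube = {x. \<forall>i. 0 < x $ i \<and> x $ i < 1}"

definition partial_deriv :: "3 \<Rightarrow> (real ^ 3 \<Rightarrow> complex) \<Rightarrow> real ^ 3 \<Rightarrow> complex" where
  "partial_deriv i u x = vector_derivative (\<lambda>t. u (x + t *\<^sub>R axis i 1)) (at 0)"

text \<open>
  Derivatives are classical ones. The norm is only applied to trigonometric polynomials, for
  which they agree with the weak derivatives.
\<close>

definition sobolev_norm :: "nat \<Rightarrow> (real ^ 3 \<Rightarrow> complex) \<Rightarrow> real" where
  "sobolev_norm s u = sqrt (\<Sum>(\<alpha>, \<beta>, \<gamma>)\<in>{(\<alpha>, \<beta>, \<gamma>). \<alpha> + \<beta> + \<gamma> \<le> s}.
     (LINT x:unit_cube|lborel.
        (norm ((partial_deriv 1 ^^ \<alpha>) ((partial_deriv 2 ^^ \<beta>) ((partial_deriv 3 ^^ \<gamma>) u)) x))\<^sup>2))"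


section \<open>The scheme\<close>

definition flux_div :: "nat \<Rightarrow> (index \<Rightarrow> real) \<Rightarrow> index \<Rightarrow> real" where
  "flux_div K \<phi> = div_N K (\<lambda>q. (norm (grad_N K \<phi> q))\<^sup>2 *\<^sub>R grad_N K \<phi> q)"

definition N_N :: "nat \<Rightarrow> (index \<Rightarrow> real) \<Rightarrow> index \<Rightarrow> real" where
  "N_N K \<phi> p = - flux_div K \<phi> p + 2 * laplace_N K \<phi> p"

definition L_N :: "nat \<Rightarrow> real \<Rightarrow> (index \<Rightarrow> real) \<Rightarrow> index \<Rightarrow> real" where
  "L_N K a \<phi> p = a * \<phi> p + laplace_N K (laplace_N K \<phi>) p"

definition E1_N :: "nat \<Rightarrow> (index \<Rightarrow> real) \<Rightarrow> real" where
  "E1_N K \<phi> = 1 / 4 * grid_norm K 4 (grad_N K \<phi>) ^ 4 - (grid_norm K 2 (grad_N K \<phi>))\<^sup>2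
     + 2 * measure lborel unit_cube"

definition mu_init :: "nat \<Rightarrow> real \<Rightarrow> (index \<Rightarrow> real) \<Rightarrow> index \<Rightarrow> real" where
  "mu_init K a \<phi> p = - flux_div K \<phi> p + a * \<phi> p + 2 * laplace_N K \<phi> p
     + laplace_N K (laplace_N K \<phi>) p"

definition bdf2 :: "real \<Rightarrow> (int \<Rightarrow> real) \<Rightarrow> int \<Rightarrow> real" where
  "bdf2 dt u n = (3 / 2 * u (n + 1) - 2 * u n + 1 / 2 * u (n - 1)) / dt"

text \<open>Time levels are integers, so that level \<open>-1\<close> is available; levels below it are irrelevant.\<close>

definition extrapolation :: "(int \<Rightarrow> index \<Rightarrow> real) \<Rightarrow> int \<Rightarrow> index \<Rightarrow> real" where
  "extrapolation \<phi> n p = 2 * \<phi> n p - \<phi> (n - 1) p"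

definition sav_step ::
    "nat \<Rightarrow> real \<Rightarrow> real \<Rightarrow> (int \<Rightarrow> index \<Rightarrow> real) \<Rightarrow> (int \<Rightarrow> real) \<Rightarrow> int \<Rightarrow> bool" where
  "sav_step K a dt \<phi> r n \<longleftrightarrow>
     (\<forall>p. bdf2 dt (\<lambda>j. \<phi> j p) n =
        laplace_N K (\<lambda>q. r (n + 1) / sqrt (E1_N K (extrapolation \<phi> n))
                           * N_N K (extrapolation \<phi> n) q
                         + L_N K a (\<phi> (n + 1)) q) p) \<and>
     bdf2 dt r n =
       1 / (2 * sqrt (E1_N K (extrapolation \<phi> n)))
       * grid_inner K (N_N K (extrapolation \<phi> n)) (\<lambda>p. bdf2 dt (\<lambda>j. \<phi> j p) n)"

definition sav_solution ::
    "nat \<Rightarrow> real \<Rightarrow> real \<Rightarrow> (int \<Rightarrow> index \<Rightarrow> real) \<Rightarrow> (int \<Rightarrow> real) \<Rightarrow> bool" where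
  "sav_solution K a dt \<phi> r \<longleftrightarrow>
     (\<forall>n\<ge>-1. \<phi> n \<in> grid_space K) \<and>
     (\<forall>p. \<phi> (-1) p = \<phi> 0 p - dt * laplace_N K (mu_init K a (\<phi> 0)) p) \<and>
     r 0 = sqrt (E1_N K (\<phi> 0)) \<and>
     r (-1) = sqrt (E1_N K (\<phi> (-1))) \<and>
     (\<forall>n\<ge>0. sav_step K a dt \<phi> r n)"


section \<open>Adequacy of the Fourier encoding\<close>

definition root_pow :: "nat \<Rightarrow> int \<Rightarrow> complex" where
  "root_pow K q = exp (2 * of_real pi * \<i> * of_real (of_int q * mesh K))"

lemma num_pts_pos: "num_pts K > 0"
  by (simp add: num_pts_def)

lemma root_pow_add: "root_pow K (p + q) = root_pow K p * root_pow K q"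
  by (simp add: root_pow_def exp_add [symmetric] algebra_simps)

lemma cnj_root_pow: "cnj (root_pow K q) = root_pow K (- q)"
  by (simp add: root_pow_def exp_cnj)

lemma root_pow_diff: "root_pow K (d * (p - q)) = root_pow K (d * p) * root_pow K (- (d * q))"
  by (simp add: right_diff_distrib flip: root_pow_add)

lemma root_pow_eq_1_iff: "root_pow K q = 1 \<longleftrightarrow> num_pts K dvd q"
proof -
  have N: "real_of_int (num_pts K) \<noteq> 0"
    using num_pts_pos [of K] by simp
  have "root_pow K q = 1 \<longleftrightarrow> (\<exists>n::int. real_of_int q * mesh K = of_int n)"
    unfolding root_pow_def exp_eq_1 by (auto simp: mult_ac)
  also have "\<dots> \<longleftrightarrow> (\<exists>n::int. real_of_int q = of_int (num_pts K * n))"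
    using N by (simp add: mesh_def field_simps)
  also have "\<dots> \<longleftrightarrow> num_pts K dvd q"
    by (simp only: of_int_eq_iff dvd_def)
  finally show ?thesis .
qed

lemma sum_root_pow:
  "(\<Sum>l\<in>{m..<m + num_pts K}. root_pow K (l * d)) =
     (if num_pts K dvd d then of_int (num_pts K) else 0)"
proof (cases "num_pts K dvd d")
  case True
  then have "root_pow K (l * d) = 1" for l
    by (simp add: root_pow_eq_1_iff)
  then show ?thesis
    using True num_pts_pos [of K] by simp
next
  case False
  let ?I = "{m..<m + num_pts K}" and ?g = "\<lambda>l. root_pow K (l * d)"
  have ends: "?g (m + num_pts K) = ?g m"
    using root_pow_eq_1_iff [of K "num_pts K * d"] by (simp add: root_pow_add distrib_right)
  have "root_pow K d * (\<Sum>l\<in>?I. ?g l) = (\<Sum>l\<in>?I. ?g (l + 1))"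
    unfolding sum_distrib_left by (intro sum.cong refl) (simp add: distrib_right add.commute flip: root_pow_add)
  also have "\<dots> = (\<Sum>l\<in>{m + 1..<m + num_pts K + 1}. ?g l)"
    by (rule sum.reindex_bij_witness [of _ "\<lambda>l. l - 1" "\<lambda>l. l + 1"]) auto
  also have "\<dots> = (\<Sum>l\<in>insert (m + num_pts K) {m + 1..<m + num_pts K}. ?g l)"
    using num_pts_pos [of K] by (intro sum.cong) auto
  also have "\<dots> = (\<Sum>l\<in>insert m {m + 1..<m + num_pts K}. ?g l)"
    using ends by simp
  also have "\<dots> = (\<Sum>l\<in>?I. ?g l)"
    using num_pts_pos [of K] by (intro sum.cong) auto
  finally have "(root_pow K d - 1) * (\<Sum>l\<in>?I. ?g l) = 0"
    by (simp add: algebra_simps)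
  then show ?thesis
    using False by (simp add: root_pow_eq_1_iff)
qed

lemma sum_root_pow_freq:
  "(\<Sum>l\<in>{- int K..int K}. root_pow K (l * d)) =
     (if num_pts K dvd d then of_int (num_pts K) else 0)"
proof -
  have "{- int K..int K} = {- int K..<- int K + num_pts K}"
    by (auto simp: num_pts_def)
  then show ?thesis
    using sum_root_pow [of K d "- int K"] by simp
qed

lemma sum_root_pow_node:
  "(\<Sum>i\<in>{0..num_pts K - 1}. root_pow K (i * d)) =
     (if num_pts K dvd d then of_int (num_pts K) else 0)"
proof -
  have "{0..num_pts K - 1} = {0..<0 + num_pts K}"
    by auto
  then show ?thesis
    using sum_root_pow [of K d 0] by simp
qed

lemma wave_grid_point:
  "wave (l, m, n) (grid_point K (i, j, k)) =
     root_pow K (l * i) * root_pow K (m * j) * root_pow K (n * k)"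
  by (simp add: wave_def grid_point_def root_pow_def exp_add [symmetric] algebra_simps)

lemma sum_Times3:
  fixes F G H :: "'b \<Rightarrow> 'a::comm_semiring_1"
  shows "(\<Sum>(a, b, c)\<in>A \<times> B \<times> C. F a * G b * H c) = sum F A * sum G B * sum H C"
proof -
  have "(\<Sum>(a, b, c)\<in>A \<times> B \<times> C. F a * G b * H c) = (\<Sum>a\<in>A. \<Sum>b\<in>B. \<Sum>c\<in>C. F a * G b * H c)"
    by (simp add: sum.cartesian_product split_def)
  also have "\<dots> = sum F A * sum G B * sum H C"
    by (simp flip: sum_distrib_left sum_distrib_right)
  finally show ?thesis .
qed

lemma freq_orthogonality:
  "(\<Sum>\<kappa>\<in>freqs K. cnj (wave \<kappa> (grid_point K (i', j', k'))) * wave \<kappa> (grid_point K (i, j, k))) =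
     (if num_pts K dvd i - i' \<and> num_pts K dvd j - j' \<and> num_pts K dvd k - k'
      then of_int (num_pts K) ^ 3 else 0)"
proof -
  have eq: "cnj (wave (l, m, n) (grid_point K (i', j', k'))) * wave (l, m, n) (grid_point K (i, j, k)) =
      root_pow K (l * (i - i')) * root_pow K (m * (j - j')) * root_pow K (n * (k - k'))" for l m n
    by (simp add: wave_grid_point cnj_root_pow root_pow_diff mult_ac)
  show ?thesis
    unfolding freqs_def
    by (subst sum.cong [OF refl, where h = "\<lambda>(l, m, n). root_pow K (l * (i - i'))
          * root_pow K (m * (j - j')) * root_pow K (n * (k - k'))"])
      (auto simp: eq sum_Times3 sum_root_pow_freq power3_eq_cube)
qed

lemma node_orthogonality:
  "(\<Sum>p\<in>nodes K. cnj (wave (l', m', n') (grid_point K p)) * wave (l, m, n) (grid_point K p)) =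
     (if num_pts K dvd l - l' \<and> num_pts K dvd m - m' \<and> num_pts K dvd n - n'
      then of_int (num_pts K) ^ 3 else 0)"
proof -
  have eq: "cnj (wave (l', m', n') (grid_point K (i, j, k))) * wave (l, m, n) (grid_point K (i, j, k)) =
      root_pow K (i * (l - l')) * root_pow K (j * (m - m')) * root_pow K (k * (n - n'))" for i j k
    by (simp add: wave_grid_point cnj_root_pow root_pow_diff mult_ac)
  show ?thesis
    unfolding nodes_def
    by (subst sum.cong [OF refl, where h = "\<lambda>(i, j, k). root_pow K (i * (l - l'))
          * root_pow K (j * (m - m')) * root_pow K (k * (n - n'))"])
      (auto simp: eq sum_Times3 sum_root_pow_node power3_eq_cube)
qed

lemma mesh_cube: "complex_of_real (mesh K ^ 3) * of_int (num_pts K) ^ 3 = 1"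
  using num_pts_pos [of K] by (simp add: mesh_def power_divide)

lemma periodic_int_mult:
  fixes g :: "int \<Rightarrow> 'a" and N :: int
  assumes "\<And>i. g (i + N) = g i"
  shows "g (i + q * N) = g i"
proof (induction q rule: int_induct [where k = 0])
  case (step1 q)
  then show ?case using assms [of "i + q * N"] by (simp add: algebra_simps)
next
  case (step2 q)
  then show ?case using assms [of "i + (q - 1) * N"] by (simp add: algebra_simps)
qed simp

lemma periodic_mod:
  fixes g :: "int \<Rightarrow> 'a" and N :: int
  assumes "\<And>i. g (i + N) = g i"
  shows "g (i mod N) = g i"
  using periodic_int_mult [of g N "i mod N" "i div N"] assms by simp

lemma grid_space_mod:
  assumes "f \<in> grid_space K"
  shows "f (i mod num_pts K, j mod num_pts K, k mod num_pts K) = f (i, j, k)"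
proof -
  have per: "f (i + num_pts K, j, k) = f (i, j, k)" "f (i, j + num_pts K, k) = f (i, j, k)"
    "f (i, j, k + num_pts K) = f (i, j, k)" for i j k
    using assms by (simp_all add: grid_space_def)
  show ?thesis
    using periodic_mod [of "\<lambda>i. f (i, j mod num_pts K, k mod num_pts K)" "num_pts K" i]
      periodic_mod [of "\<lambda>j. f (i, j, k mod num_pts K)" "num_pts K" j]
      periodic_mod [of "\<lambda>k. f (i, j, k)" "num_pts K" k] per
    by simp
qed

lemma finite_nodes [simp]: "finite (nodes K)"
  by (simp add: nodes_def)

lemma finite_freqs [simp]: "finite (freqs K)"
  by (simp add: freqs_def)

theorem dft_expansion:
  assumes "f \<in> grid_space K"
  shows "complex_of_real (f p) = (\<Sum>\<kappa>\<in>freqs K. dft K f \<kappa> * wave \<kappa> (grid_point K p))"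
proof -
  obtain i j k where p: "p = (i, j, k)" by (cases p)
  define N where "N = num_pts K"
  define p0 where "p0 = (i mod N, j mod N, k mod N)"
  have N: "N > 0" using num_pts_pos [of K] by (simp add: N_def)
  have p0: "p0 \<in> nodes K"
    using N by (auto simp: p0_def nodes_def N_def [symmetric])
  have dvd_iff: "N dvd a - a' \<longleftrightarrow> a' = a mod N" if "0 \<le> a'" "a' \<le> N - 1" for a a'
    using that N by (metis mod_eq_dvd_iff mod_pos_pos_trivial zle_diff1_eq)
  have ker: "(\<Sum>\<kappa>\<in>freqs K. cnj (wave \<kappa> (grid_point K q)) * wave \<kappa> (grid_point K p)) =
      (if q = p0 then of_int N ^ 3 else 0)" if "q \<in> nodes K" for q
  proof -
    obtain i' j' k' where q: "q = (i', j', k')" by (cases q)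
    show ?thesis
      using that dvd_iff unfolding q p freq_orthogonality p0_def nodes_def N_def [symmetric] by auto
  qed
  have "(\<Sum>\<kappa>\<in>freqs K. dft K f \<kappa> * wave \<kappa> (grid_point K p)) =
      (\<Sum>\<kappa>\<in>freqs K. \<Sum>q\<in>nodes K. of_real (mesh K ^ 3) * of_real (f q) *
         (cnj (wave \<kappa> (grid_point K q)) * wave \<kappa> (grid_point K p)))"
    by (simp add: dft_def sum_distrib_left sum_distrib_right mult_ac)
  also have "\<dots> = (\<Sum>q\<in>nodes K. of_real (mesh K ^ 3) * of_real (f q) *
      (\<Sum>\<kappa>\<in>freqs K. cnj (wave \<kappa> (grid_point K q)) * wave \<kappa> (grid_point K p)))"
    by (subst sum.swap) (simp add: sum_distrib_left)
  also have "\<dots> = (\<Sum>q\<in>nodes K. if q = p0 then of_real (mesh K ^ 3) * of_real (f q) * of_int N ^ 3 else 0)"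
    by (intro sum.cong) (auto simp: ker)
  also have "\<dots> = of_real (mesh K ^ 3) * of_int N ^ 3 * of_real (f p0)"
    using p0 by (simp add: sum.delta)
  also have "\<dots> = of_real (f p0)"
    using mesh_cube [of K] by (simp add: N_def)
  also have "f p0 = f p"
    using grid_space_mod [OF assms] by (simp add: p0_def p N_def)
  finally show ?thesis by simp
qed

theorem dft_unique:
  assumes "\<And>p. complex_of_real (f p) = (\<Sum>\<kappa>\<in>freqs K. c \<kappa> * wave \<kappa> (grid_point K p))"
    and "\<kappa> \<in> freqs K"
  shows "c \<kappa> = dft K f \<kappa>"
proof -
  obtain l m n where \<kappa>: "\<kappa> = (l, m, n)" by (cases \<kappa>)
  define N where "N = num_pts K"
  have dvd_iff: "N dvd a' - a \<longleftrightarrow> a' = a"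
    if "- int K \<le> a" "a \<le> int K" "- int K \<le> a'" "a' \<le> int K" for a a'
  proof
    assume "N dvd a' - a"
    moreover have "\<bar>a' - a\<bar> < N" using that by (simp add: N_def num_pts_def)
    ultimately have "a' - a = 0"
      by (meson dvd_imp_le_int abs_ge_self order_less_le_trans not_less order_trans)
    then show "a' = a" by simp
  qed simp
  have ker: "(\<Sum>p\<in>nodes K. cnj (wave \<kappa> (grid_point K p)) * wave \<eta> (grid_point K p)) =
      (if \<eta> = \<kappa> then of_int N ^ 3 else 0)" if "\<eta> \<in> freqs K" for \<eta>
  proof -
    obtain l' m' n' where \<eta>: "\<eta> = (l', m', n')" by (cases \<eta>)
    show ?thesis
      using that assms(2) dvd_iff unfolding \<eta> \<kappa> node_orthogonality freqs_def N_def [symmetric] by auto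
  qed
  have "dft K f \<kappa> = of_real (mesh K ^ 3) * (\<Sum>p\<in>nodes K. \<Sum>\<eta>\<in>freqs K.
      c \<eta> * (cnj (wave \<kappa> (grid_point K p)) * wave \<eta> (grid_point K p)))"
    by (simp add: dft_def assms(1) sum_distrib_left sum_distrib_right mult_ac)
  also have "\<dots> = of_real (mesh K ^ 3) * (\<Sum>\<eta>\<in>freqs K. c \<eta> *
      (\<Sum>p\<in>nodes K. cnj (wave \<kappa> (grid_point K p)) * wave \<eta> (grid_point K p)))"
    by (subst sum.swap) (simp add: sum_distrib_left)
  also have "\<dots> = of_real (mesh K ^ 3) * (\<Sum>\<eta>\<in>freqs K. if \<eta> = \<kappa> then c \<eta> * of_int N ^ 3 else 0)"
    by (intro arg_cong2 [where f = "(*)"] refl sum.cong) (auto simp: ker)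
  also have "\<dots> = of_real (mesh K ^ 3) * of_int N ^ 3 * c \<kappa>"
    using assms(2) by (simp add: sum.delta)
  also have "\<dots> = c \<kappa>"
    using mesh_cube [of K] by (simp add: N_def)
  finally show ?thesis by simp
qed

lemma of_real_fourier_multiplier:
  assumes "\<And>l m n. \<sigma> (- l, - m, - n) = cnj (\<sigma> (l, m, n))"
  shows "complex_of_real (fourier_multiplier K \<sigma> f p) =
    (\<Sum>\<kappa>\<in>freqs K. \<sigma> \<kappa> * dft K f \<kappa> * wave \<kappa> (grid_point K p))"
proof -
  let ?T = "\<lambda>\<kappa>. \<sigma> \<kappa> * dft K f \<kappa> * wave \<kappa> (grid_point K p)"
  have w: "wave (- l, - m, - n) x = cnj (wave (l, m, n) x)" for l m n x
    unfolding wave_def split_conv exp_cnj by (rule arg_cong [where f = exp]) (simp add: algebra_simps)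
  have d: "dft K f (- l, - m, - n) = cnj (dft K f (l, m, n))" for l m n
    by (simp add: dft_def w cnj_sum)
  have "cnj (\<Sum>\<kappa>\<in>freqs K. ?T \<kappa>) = (\<Sum>\<kappa>\<in>freqs K. ?T \<kappa>)"
    unfolding cnj_sum
    by (rule sum.reindex_bij_witness [of _ "\<lambda>(l, m, n). (- l, - m, - n)" "\<lambda>(l, m, n). (- l, - m, - n)"])
      (auto simp: freqs_def assms w d)
  then have "(\<Sum>\<kappa>\<in>freqs K. ?T \<kappa>) \<in> \<real>"
    by (simp add: Reals_cnj_iff)
  then show ?thesis
    unfolding fourier_multiplier_def by (rule of_real_Re)
qed

theorem of_real_D:
  "complex_of_real (Dx K f p) =
     (\<Sum>(l, m, n)\<in>freqs K. 2 * of_real pi * \<i> * of_int l * dft K f (l, m, n) * wave (l, m, n) (grid_point K p))"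
  "complex_of_real (Dy K f p) =
     (\<Sum>(l, m, n)\<in>freqs K. 2 * of_real pi * \<i> * of_int m * dft K f (l, m, n) * wave (l, m, n) (grid_point K p))"
  "complex_of_real (Dz K f p) =
     (\<Sum>(l, m, n)\<in>freqs K. 2 * of_real pi * \<i> * of_int n * dft K f (l, m, n) * wave (l, m, n) (grid_point K p))"
  unfolding Dx_def Dy_def Dz_def
  by (subst of_real_fourier_multiplier; auto intro!: sum.cong)+

end

theory Submission
  imports Defs
begin

text \<open>
  The proof takes place entirely on the Fourier side. It combines the unconditional stability of the scheme
  with a bootstrap in which the solution is estimated mode by mode, uniformly in time.

  Testing the scheme shows that a modified energy decreases (\<open>sav_energy_decreasing\<close>). Hence second
  derivatives of the solution and the auxiliary variable \<open>r\<close> are bounded for all times by the initial data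
  (\<open>uniform_H2_bound\<close>). This holds for every step size. Since \<open>E1_N\<close> is at least 1, the scalar factor in
  front of the nonlinearity is bounded as well.

  In each mode the scheme is the two-step backward differentiation formula for a damped scalar equation with
  damping rate of order \<open>|\<kappa>|^6\<close>. Such a recursion is bounded by its initial values plus the supremum over all
  times of the forcing divided by the damping rate, with an absolute constant (\<open>bdf2_mode_bound\<close>). This replaces
  an energy estimate in \<open>H^3\<close>, whose explicitly treated nonlinear term would require more than three derivatives
  of the initial data. After the division, the cubic term contributes \<open>|\<kappa>|^(-3)\<close> times a
  coefficient of \<open>|\<nabla>\<psi>|^2 \<nabla>\<psi>\<close>, where \<open>\<psi>\<close> is the extrapolated solution.

  The price of working mode by mode is that suprema in time are taken inside the sums over frequencies, so each
  step has to bound the modes by one fixed sequence. Two steps suffice. By \<open>cconv_cube_sup_le\<close>, the bound on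
  second derivatives makes the coefficients of the cubic flux \<open>O(1 / |\<kappa>|)\<close>. The modes of the solution are
  therefore at most initial values plus \<open>O(|\<kappa>|^(-4))\<close>, a fixed sequence with more than two square summable
  derivatives. By \<open>wsum_cconv_cube_le\<close>, the cubic flux built from this sequence is square summable, which after
  the gain of three powers of \<open>|\<kappa>|\<close> is the claim.

  Both estimates rest on one product estimate for cyclic convolutions (\<open>wsum_cconv_le\<close>). Aliasing is harmless in it
  because folding a wave vector back into the frequency box never increases its size. The correspondence
  between the Sobolev norm of the interpolant and weighted sums of coefficients is exact up to constants
  (\<open>wsum_6_le_sobolev_norm\<close>, \<open>sobolev_norm_le_wsum_6\<close>).
\<close>

section \<open>Cyclic arithmetic of wave vectors\<close>

text \<open>
  Pointwise products of grid functions alias: their Fourier coefficients are convolutions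
  modulo \<open>N\<close>. All sequences are therefore read on the representatives \<open>freqs K\<close>, and indices that
  leave this box are folded back into it.
\<close>

definition fold1 :: "nat \<Rightarrow> int \<Rightarrow> int" where
  "fold1 K l = (l + int K) mod num_pts K - int K"

definition fold_freq :: "nat \<Rightarrow> index \<Rightarrow> index" where
  "fold_freq K = (\<lambda>(l, m, n). (fold1 K l, fold1 K m, fold1 K n))"

lemma fold1_range: "- int K \<le> fold1 K l" "fold1 K l \<le> int K"
  using pos_mod_bound [OF num_pts_pos, of "l + int K" K] pos_mod_sign [OF num_pts_pos, of "l + int K" K]
  by (auto simp: fold1_def num_pts_def)

lemma fold1_id: "- int K \<le> l \<Longrightarrow> l \<le> int K \<Longrightarrow> fold1 K l = l"
  by (simp add: fold1_def num_pts_def)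

lemma fold1_dvd: "num_pts K dvd fold1 K l - l"
proof -
  have "fold1 K l - l = - ((l + int K) div num_pts K) * num_pts K"
    using div_mult_mod_eq [of "l + int K" "num_pts K"] unfolding fold1_def by linarith
  then show ?thesis by simp
qed

lemma fold1_cong: "num_pts K dvd l - l' \<Longrightarrow> fold1 K l = fold1 K l'"
  unfolding fold1_def by (auto simp: mod_eq_dvd_iff)

lemma fold1_fold:
  "fold1 K (l - fold1 K m) = fold1 K (l - m)"
  "fold1 K (fold1 K l - m) = fold1 K (l - m)"
  "fold1 K (l + fold1 K m) = fold1 K (l + m)"
  "fold1 K (fold1 K l + m) = fold1 K (l + m)"
  by (rule fold1_cong; use fold1_dvd [of K l] fold1_dvd [of K m] in
      \<open>simp add: algebra_simps dvd_diff_commute\<close>)+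

text \<open>
  Aliasing only lowers frequencies, since \<open>{- K..K}\<close> holds the residues of least modulus. This
  is why the pseudo-spectral product obeys the same weighted estimates as the exact product.
\<close>

lemma abs_fold1_le: "\<bar>fold1 K l\<bar> \<le> \<bar>l\<bar>"
  using fold1_range [of K l] fold1_id [of K l] by linarith

lemma fold_freq_in [simp]: "fold_freq K \<kappa> \<in> freqs K"
  by (cases \<kappa>) (simp add: fold_freq_def freqs_def fold1_range)

lemma fold_freq_id: "\<kappa> \<in> freqs K \<Longrightarrow> fold_freq K \<kappa> = \<kappa>"
  by (cases \<kappa>) (auto simp: fold_freq_def freqs_def fold1_id)

lemma fold_freq_fold:
  "fold_freq K (\<kappa> - fold_freq K \<eta>) = fold_freq K (\<kappa> - \<eta>)"
  "fold_freq K (fold_freq K \<kappa> - \<eta>) = fold_freq K (\<kappa> - \<eta>)"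
  "fold_freq K (fold_freq K \<kappa> + \<eta>) = fold_freq K (\<kappa> + \<eta>)"
  by (cases \<kappa>; cases \<eta>; simp add: fold_freq_def fold1_fold)+

lemma sum_freqs_reflect:
  "(\<Sum>\<eta>\<in>freqs K. h (fold_freq K (\<kappa> - \<eta>))) = (\<Sum>\<eta>\<in>freqs K. h \<eta>)"
  by (rule sum.reindex_bij_witness
      [of _ "\<lambda>\<eta>. fold_freq K (\<kappa> - \<eta>)" "\<lambda>\<eta>. fold_freq K (\<kappa> - \<eta>)"])
    (auto simp: fold_freq_fold fold_freq_id)

lemma sum_freqs_shift:
  "(\<Sum>\<kappa>\<in>freqs K. h (fold_freq K (\<kappa> - \<eta>))) = (\<Sum>\<kappa>\<in>freqs K. h \<kappa>)"
  by (rule sum.reindex_bij_witness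
      [of _ "\<lambda>\<kappa>. fold_freq K (\<kappa> + \<eta>)" "\<lambda>\<kappa>. fold_freq K (\<kappa> - \<eta>)"])
    (auto simp: fold_freq_fold fold_freq_id)

definition cconv :: "nat \<Rightarrow> (index \<Rightarrow> real) \<Rightarrow> (index \<Rightarrow> real) \<Rightarrow> index \<Rightarrow> real" where
  "cconv K A B \<kappa> = (\<Sum>\<eta>\<in>freqs K. A \<eta> * B (fold_freq K (\<kappa> - \<eta>)))"

lemma cconv_commute:
  assumes "\<kappa> \<in> freqs K"
  shows "cconv K A B \<kappa> = cconv K B A \<kappa>"
proof -
  have "cconv K A B \<kappa> = (\<Sum>\<eta>\<in>freqs K. (\<lambda>\<zeta>. A (fold_freq K (\<kappa> - \<zeta>)) * B \<zeta>) (fold_freq K (\<kappa> - \<eta>)))"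
    unfolding cconv_def by (intro sum.cong refl) (simp add: fold_freq_fold fold_freq_id)
  also have "\<dots> = cconv K B A \<kappa>"
    by (subst sum_freqs_reflect) (simp add: cconv_def mult.commute)
  finally show ?thesis .
qed

text \<open>
  Together with commutativity this moves a distinguished factor of a triple product to the front,
  whichever position the Leibniz rule left it in.
\<close>

lemma cconv_left_commute: "cconv K A (cconv K B C) \<kappa> = cconv K B (cconv K A C) \<kappa>"
proof -
  have "cconv K A (cconv K B C) \<kappa> =
      (\<Sum>\<eta>\<in>freqs K. \<Sum>\<zeta>\<in>freqs K. A \<eta> * (B \<zeta> * C (fold_freq K (\<kappa> - \<eta> - \<zeta>))))"
    by (simp add: cconv_def fold_freq_fold sum_distrib_left)
  also have "\<dots> = (\<Sum>\<zeta>\<in>freqs K. \<Sum>\<eta>\<in>freqs K. A \<eta> * (B \<zeta> * C (fold_freq K (\<kappa> - \<zeta> - \<eta>))))"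
    by (subst sum.swap) (simp only: cancel_ab_semigroup_add_class.diff_right_commute [of \<kappa>])
  also have "\<dots> = cconv K B (cconv K A C) \<kappa>"
    by (simp add: cconv_def fold_freq_fold sum_distrib_left mult.left_commute)
  finally show ?thesis .
qed

lemma cconv_nonneg:
  "(\<And>\<eta>. 0 \<le> A \<eta>) \<Longrightarrow> (\<And>\<eta>. 0 \<le> B \<eta>) \<Longrightarrow> 0 \<le> cconv K A B \<kappa>"
  unfolding cconv_def by (intro sum_nonneg mult_nonneg_nonneg)

lemma cconv_mono:
  assumes "\<And>\<eta>. \<eta> \<in> freqs K \<Longrightarrow> A \<eta> \<le> A' \<eta>" "\<And>\<eta>. \<eta> \<in> freqs K \<Longrightarrow> B \<eta> \<le> B' \<eta>"
    and "\<And>\<eta>. 0 \<le> A \<eta>" "\<And>\<eta>. 0 \<le> B \<eta>"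
  shows "cconv K A B \<kappa> \<le> cconv K A' B' \<kappa>"
  unfolding cconv_def
  by (intro sum_mono mult_mono assms fold_freq_in order_trans [OF assms(3) assms(1)])

lemma cconv_scale:
  "cconv K (\<lambda>\<eta>. c * A \<eta>) B \<kappa> = c * cconv K A B \<kappa>"
  "cconv K A (\<lambda>\<eta>. c * B \<eta>) \<kappa> = c * cconv K A B \<kappa>"
  by (simp_all add: cconv_def sum_distrib_left mult_ac)

definition cconv_cube :: "nat \<Rightarrow> (index \<Rightarrow> real) \<Rightarrow> index \<Rightarrow> real" where
  "cconv_cube K A = cconv K A (cconv K A A)"

lemma cconv_cube_mono:
  assumes "\<And>\<eta>. \<eta> \<in> freqs K \<Longrightarrow> A \<eta> \<le> B \<eta>" "\<And>\<eta>. 0 \<le> A \<eta>"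
  shows "cconv_cube K A \<kappa> \<le> cconv_cube K B \<kappa>"
  unfolding cconv_cube_def by (intro cconv_mono cconv_nonneg assms)

lemma cconv_cube_nonneg: "(\<And>\<eta>. 0 \<le> A \<eta>) \<Longrightarrow> 0 \<le> cconv_cube K A \<kappa>"
  unfolding cconv_cube_def by (intro cconv_nonneg)

lemma cconv_cube_scale:
  "cconv_cube K (\<lambda>\<eta>. c * A \<eta>) \<kappa> = c ^ 3 * cconv_cube K A \<kappa>"
proof -
  have "cconv K (\<lambda>\<eta>. c * A \<eta>) (\<lambda>\<eta>. c * A \<eta>) = (\<lambda>\<kappa>. c\<^sup>2 * cconv K A A \<kappa>)"
    by (simp add: cconv_scale fun_eq_iff power2_eq_square mult.assoc)
  then show ?thesis by (simp add: cconv_cube_def cconv_scale power2_eq_square power3_eq_cube mult_ac)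
qed

section \<open>Discrete Fourier calculus\<close>

lemma root_pow_cong: "num_pts K dvd p - q \<Longrightarrow> root_pow K p = root_pow K q"
proof -
  assume "num_pts K dvd p - q"
  then have "root_pow K (p - q) = 1" by (simp add: root_pow_eq_1_iff)
  then show ?thesis using root_pow_add [of K "p - q" q] by simp
qed

lemma wave_fold: "wave (fold_freq K \<kappa>) (grid_point K p) = wave \<kappa> (grid_point K p)"
proof -
  have *: "root_pow K (fold1 K l * i) = root_pow K (l * i)" for l i
    using fold1_dvd [of K l] by (intro root_pow_cong) (simp flip: left_diff_distrib)
  show ?thesis
    by (cases \<kappa>; cases p) (simp add: fold_freq_def wave_grid_point *)
qed

lemma wave_diff: "wave (\<kappa> - \<eta>) x = wave \<kappa> x * cnj (wave \<eta> x)"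
  by (cases \<kappa>; cases \<eta>) (simp add: wave_def exp_cnj exp_add [symmetric] algebra_simps)

lemma norm_wave [simp]: "norm (wave \<kappa> x) = 1"
proof -
  obtain l m n where "\<kappa> = (l, m, n)" by (cases \<kappa>)
  then have "wave \<kappa> x = cis (2 * pi * (of_int l * x $ 1 + of_int m * x $ 2 + of_int n * x $ 3))"
    by (simp add: wave_def cis_conv_exp mult_ac)
  then show ?thesis by simp
qed

lemma dft_mult:
  assumes "f \<in> grid_space K"
  shows "dft K (\<lambda>p. f p * g p) \<kappa> = (\<Sum>\<eta>\<in>freqs K. dft K f \<eta> * dft K g (fold_freq K (\<kappa> - \<eta>)))"
proof -
  have "dft K (\<lambda>p. f p * g p) \<kappa> = of_real (mesh K ^ 3) * (\<Sum>p\<in>nodes K. \<Sum>\<eta>\<in>freqs K.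
      dft K f \<eta> * wave \<eta> (grid_point K p) * (of_real (g p) * cnj (wave \<kappa> (grid_point K p))))"
    by (simp add: dft_def [of K "\<lambda>p. f p * g p"] dft_expansion [OF assms] sum_distrib_right mult.assoc)
  also have "\<dots> = (\<Sum>\<eta>\<in>freqs K. dft K f \<eta> * dft K g (fold_freq K (\<kappa> - \<eta>)))"
    by (subst sum.swap)
      (simp add: dft_def [of K g] wave_fold wave_diff sum_distrib_left mult_ac)
  finally show ?thesis .
qed

lemma parseval:
  assumes "f \<in> grid_space K"
  shows "complex_of_real (grid_inner K f g) = (\<Sum>\<kappa>\<in>freqs K. dft K f \<kappa> * cnj (dft K g \<kappa>))"
proof -
  have "complex_of_real (grid_inner K f g) = of_real (mesh K ^ 3) * (\<Sum>p\<in>nodes K. \<Sum>\<eta>\<in>freqs K.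
      dft K f \<eta> * wave \<eta> (grid_point K p) * of_real (g p))"
    by (simp add: grid_inner_def dft_expansion [OF assms] sum_distrib_right)
  also have "\<dots> = (\<Sum>\<kappa>\<in>freqs K. dft K f \<kappa> * cnj (dft K g \<kappa>))"
    by (subst sum.swap)
      (simp add: dft_def [of K g] sum_distrib_left mult_ac)
  finally show ?thesis .
qed

lemma dft_add: "dft K (\<lambda>p. f p + g p) \<kappa> = dft K f \<kappa> + dft K g \<kappa>"
  by (simp add: dft_def distrib_right distrib_left sum.distrib)

lemma dft_scale: "dft K (\<lambda>p. c * f p) \<kappa> = of_real c * dft K f \<kappa>"
  by (simp add: dft_def sum_distrib_left mult_ac)

lemma fourier_multiplier_in_grid_space: "fourier_multiplier K \<sigma> f \<in> grid_space K"
proof -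
  have r: "root_pow K (l * (i + num_pts K)) = root_pow K (l * i)" for l i
    by (rule root_pow_cong) (simp add: algebra_simps)
  have "wave \<kappa> (grid_point K (i + num_pts K, j, k)) = wave \<kappa> (grid_point K (i, j, k))"
    "wave \<kappa> (grid_point K (i, j + num_pts K, k)) = wave \<kappa> (grid_point K (i, j, k))"
    "wave \<kappa> (grid_point K (i, j, k + num_pts K)) = wave \<kappa> (grid_point K (i, j, k))" for \<kappa> i j k
    by (cases \<kappa>; simp add: wave_grid_point r)+
  then show ?thesis
    unfolding grid_space_def fourier_multiplier_def by simp
qed

definition wave_comp :: "3 \<Rightarrow> index \<Rightarrow> int" where
  "wave_comp i = (\<lambda>(l, m, n). if i = 1 then l else if i = 2 then m else n)"

definition D_N :: "nat \<Rightarrow> 3 \<Rightarrow> (index \<Rightarrow> real) \<Rightarrow> index \<Rightarrow> real" where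
  "D_N K i = fourier_multiplier K (\<lambda>\<kappa>. 2 * of_real pi * \<i> * of_int (wave_comp i \<kappa>))"

lemma D_N_simps: "Dx K = D_N K 1" "Dy K = D_N K 2" "Dz K = D_N K 3"
  unfolding Dx_def Dy_def Dz_def D_N_def
  by (rule arg_cong [where f = "fourier_multiplier K"]; auto simp: wave_comp_def)+

lemma D_N_in_grid_space: "D_N K i f \<in> grid_space K"
  by (simp add: D_N_def fourier_multiplier_in_grid_space)

lemma wave_comp_uminus: "wave_comp i (- l, - m, - n) = - wave_comp i (l, m, n)"
  by (simp add: wave_comp_def)

lemma D_N_symbol_cnj:
  "2 * of_real pi * \<i> * of_int (wave_comp i (- l, - m, - n)) =
     cnj (2 * of_real pi * \<i> * of_int (wave_comp i (l, m, n)))"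
  by (simp add: wave_comp_uminus)

lemma dft_D_N:
  assumes "\<kappa> \<in> freqs K"
  shows "dft K (D_N K i f) \<kappa> = 2 * of_real pi * \<i> * of_int (wave_comp i \<kappa>) * dft K f \<kappa>"
proof -
  let ?c = "\<lambda>\<kappa>. 2 * of_real pi * \<i> * of_int (wave_comp i \<kappa>) * dft K f \<kappa>"
  have "complex_of_real (D_N K i f p) = (\<Sum>\<kappa>\<in>freqs K. ?c \<kappa> * wave \<kappa> (grid_point K p))" for p
    unfolding D_N_def by (rule of_real_fourier_multiplier [OF D_N_symbol_cnj])
  from dft_unique [where c = ?c, OF this assms] show ?thesis by simp
qed

lemma grad_N_nth: "grad_N K f p $ i = D_N K i f p"
  using exhaust_3 [of i] by (auto simp: grad_N_def D_N_simps)

lemma dft_div_N: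
  assumes "\<kappa> \<in> freqs K"
  shows "dft K (div_N K F) \<kappa> = (\<Sum>i\<in>UNIV. 2 * of_real pi * \<i> * of_int (wave_comp i \<kappa>) * dft K (\<lambda>q. F q $ i) \<kappa>)"
proof -
  have "div_N K F = (\<lambda>p. D_N K 1 (\<lambda>q. F q $ 1) p + D_N K 2 (\<lambda>q. F q $ 2) p + D_N K 3 (\<lambda>q. F q $ 3) p)"
    by (simp add: div_N_def D_N_simps fun_eq_iff)
  then show ?thesis
    using assms by (simp add: dft_add dft_D_N sum_3)
qed

text \<open>
  The eigenvalue of \<open>- laplace_N K\<close> on the wave \<open>\<kappa>\<close> of \<open>freqs K\<close>.
\<close>

definition lam :: "index \<Rightarrow> real" where
  "lam \<kappa> = (2 * pi)\<^sup>2 * (\<Sum>i\<in>UNIV. (of_int (wave_comp i \<kappa>))\<^sup>2)"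

lemma dft_laplace_N:
  assumes "\<kappa> \<in> freqs K"
  shows "dft K (laplace_N K f) \<kappa> = - of_real (lam \<kappa>) * dft K f \<kappa>"
proof -
  have "dft K (laplace_N K f) \<kappa> = (\<Sum>i\<in>UNIV. 2 * of_real pi * \<i> * of_int (wave_comp i \<kappa>) *
      (2 * of_real pi * \<i> * of_int (wave_comp i \<kappa>) * dft K f \<kappa>))"
    using assms by (simp add: laplace_N_def dft_div_N grad_N_nth dft_D_N)
  also have "\<dots> = - of_real (lam \<kappa>) * dft K f \<kappa>"
    by (simp add: sum_3 lam_def power2_eq_square algebra_simps)
  finally show ?thesis .
qed

lemma dft_N_N:
  assumes "\<kappa> \<in> freqs K"
  shows "dft K (N_N K \<psi>) \<kappa> =
    - (\<Sum>i\<in>UNIV. 2 * of_real pi * \<i> * of_int (wave_comp i \<kappa>) *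
         dft K (\<lambda>q. (norm (grad_N K \<psi> q))\<^sup>2 * D_N K i \<psi> q) \<kappa>)
    - 2 * of_real (lam \<kappa>) * dft K \<psi> \<kappa>"
proof -
  have "N_N K \<psi> = (\<lambda>p. (- 1) * flux_div K \<psi> p + 2 * laplace_N K \<psi> p)"
    by (simp add: N_N_def fun_eq_iff)
  then have "dft K (N_N K \<psi>) \<kappa> = - dft K (flux_div K \<psi>) \<kappa> + 2 * dft K (laplace_N K \<psi>) \<kappa>"
    by (simp only: dft_add dft_scale) simp
  moreover have "flux_div K \<psi> = div_N K (\<lambda>q. (norm (grad_N K \<psi> q))\<^sup>2 *\<^sub>R grad_N K \<psi> q)"
    by (simp add: flux_div_def fun_eq_iff)
  ultimately show ?thesis
    by (simp add: dft_laplace_N [OF assms] dft_div_N [OF assms] grad_N_nth)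
qed

section \<open>Weighted sums over the wave vectors\<close>

text \<open>
  A weight of the order of \<open>1 + |\<kappa>|\<close>. The value 1 at the zero mode lets it be raised to negative
  powers, and the maximum norm suits folding, which acts on each component separately.
\<close>

definition freq_size :: "index \<Rightarrow> real" where
  "freq_size = (\<lambda>(l, m, n). max 1 (max \<bar>of_int l\<bar> (max \<bar>of_int m\<bar> \<bar>of_int n\<bar>)))"

lemma freq_size_ge_1: "1 \<le> freq_size \<kappa>"
  by (cases \<kappa>) (simp add: freq_size_def)

lemma freq_size_pos [simp]: "0 < freq_size \<kappa>" "0 \<le> freq_size \<kappa>" "freq_size \<kappa> \<noteq> 0"
  using freq_size_ge_1 [of \<kappa>] by auto

lemma wave_comp_le_freq_size: "\<bar>of_int (wave_comp i \<kappa>)\<bar> \<le> freq_size \<kappa>"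
  by (cases \<kappa>) (auto simp: freq_size_def wave_comp_def le_max_iff_disj)

lemma freq_size_leI:
  assumes "1 \<le> b" "\<And>i. \<bar>of_int (wave_comp i \<kappa>)\<bar> \<le> b"
  shows "freq_size \<kappa> \<le> b"
  using assms(1) assms(2) [of 1] assms(2) [of 2] assms(2) [of 3]
  by (cases \<kappa>) (simp add: freq_size_def wave_comp_def)

text \<open>
  Subadditivity survives folding because \<open>\<kappa>\<close> is the folded sum of \<open>\<eta>\<close> and the folded difference, and
  folding does not increase the modulus of a component. It serves as the Leibniz rule for \<open>cconv\<close>.
\<close>

lemma freq_size_triangle:
  assumes "\<kappa> \<in> freqs K"
  shows "freq_size \<kappa> \<le> freq_size \<eta> + freq_size (fold_freq K (\<kappa> - \<eta>))"
proof (rule freq_size_leI)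
  show "1 \<le> freq_size \<eta> + freq_size (fold_freq K (\<kappa> - \<eta>))"
    by (simp add: freq_size_ge_1 add_increasing2)
  fix i
  have range: "- int K \<le> wave_comp i \<kappa>" "wave_comp i \<kappa> \<le> int K"
    using assms by (auto simp: wave_comp_def freqs_def)
  have comp: "wave_comp i (fold_freq K (\<kappa> - \<eta>)) = fold1 K (wave_comp i \<kappa> - wave_comp i \<eta>)"
    by (cases \<kappa>; cases \<eta>) (simp add: wave_comp_def fold_freq_def)
  have "wave_comp i \<kappa> = fold1 K (wave_comp i \<eta> + fold1 K (wave_comp i \<kappa> - wave_comp i \<eta>))"
    using fold1_id [OF range] by (simp add: fold1_fold)
  then have "\<bar>wave_comp i \<kappa>\<bar> \<le> \<bar>wave_comp i \<eta> + fold1 K (wave_comp i \<kappa> - wave_comp i \<eta>)\<bar>"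
    using abs_fold1_le by metis
  then have "\<bar>wave_comp i \<kappa>\<bar> \<le> \<bar>wave_comp i \<eta>\<bar> + \<bar>wave_comp i (fold_freq K (\<kappa> - \<eta>))\<bar>"
    unfolding comp by linarith
  then have "\<bar>real_of_int (wave_comp i \<kappa>)\<bar> \<le> \<bar>of_int (wave_comp i \<eta>)\<bar> + \<bar>of_int (wave_comp i (fold_freq K (\<kappa> - \<eta>)))\<bar>"
    by (simp flip: of_int_abs of_int_add)
  also have "\<dots> \<le> freq_size \<eta> + freq_size (fold_freq K (\<kappa> - \<eta>))"
    by (intro add_mono wave_comp_le_freq_size)
  finally show "\<bar>real_of_int (wave_comp i \<kappa>)\<bar> \<le> freq_size \<eta> + freq_size (fold_freq K (\<kappa> - \<eta>))" .
qed

lemma sum_max_powr_le: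
  fixes s :: real
  assumes "1 < s"
  shows "\<exists>C. 0 \<le> C \<and> (\<forall>K. (\<Sum>l\<in>{- int K..int K}. max 1 \<bar>of_int l\<bar> powr (- s)) \<le> C)"
proof -
  let ?g = "\<lambda>n::nat. real n powr (- s)"
  have sm: "summable ?g" using assms by (simp add: summable_real_powr_iff)
  have half: "(\<Sum>n\<in>{1..K}. ?g n) \<le> suminf ?g" for K
    by (rule sum_le_suminf [OF sm]) auto
  have "(\<Sum>l\<in>{- int K..int K}. max 1 \<bar>of_int l\<bar> powr (- s)) \<le> 1 + 2 * suminf ?g" for K
  proof -
    let ?f = "\<lambda>l::int. max 1 \<bar>of_int l\<bar> powr (- s) :: real"
    have p: "(\<Sum>l\<in>int ` {1..K}. ?f l) = (\<Sum>n\<in>{1..K}. ?g n)"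
      by (subst sum.reindex) (auto intro!: sum.cong simp: max_def)
    have m: "(\<Sum>l\<in>(\<lambda>n. - int n) ` {1..K}. ?f l) = (\<Sum>n\<in>{1..K}. ?g n)"
      by (subst sum.reindex) (auto intro!: sum.cong simp: max_def inj_on_def)
    have "{- int K..int K} = insert 0 (int ` {1..K} \<union> (\<lambda>n. - int n) ` {1..K})"
    proof (intro equalityI subsetI)
      fix l assume "l \<in> {- int K..int K}"
      then show "l \<in> insert 0 (int ` {1..K} \<union> (\<lambda>n. - int n) ` {1..K})"
        by (cases l) (auto simp: image_iff intro!: bexI [where x = "nat \<bar>l\<bar>"])
    qed auto
    then have "(\<Sum>l\<in>{- int K..int K}. ?f l) = ?f 0 + (\<Sum>l\<in>int ` {1..K} \<union> (\<lambda>n. - int n) ` {1..K}. ?f l)"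
      by (subst sum.insert [symmetric]) auto
    also have "(\<Sum>l\<in>int ` {1..K} \<union> (\<lambda>n. - int n) ` {1..K}. ?f l) = 2 * (\<Sum>n\<in>{1..K}. ?g n)"
      by (subst sum.union_disjoint) (auto simp: p [simplified] m [simplified])
    finally have "(\<Sum>l\<in>{- int K..int K}. ?f l) = 1 + 2 * (\<Sum>n\<in>{1..K}. ?g n)" by simp
    then show ?thesis using half [of K] by simp
  qed
  moreover have "0 \<le> suminf ?g" by (intro suminf_nonneg sm) auto
  ultimately show ?thesis by (intro exI [of _ "1 + 2 * suminf ?g"]) auto
qed

text \<open>
  The weight dominates each component, so the sum over the cube is at most the third power of a
  one-dimensional sum with exponent \<open>7 / 6 > 1\<close>. Any exponent above 3 would do here; \<open>7 / 2\<close> is what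
  remains in the last bootstrap step, when \<open>freq_size powr - 4\<close> is squared and weighted by
  \<open>freq_size powr (9 / 2)\<close>.
\<close>

lemma sum_freq_size_le:
  "\<exists>S\<ge>0. \<forall>K. (\<Sum>\<kappa>\<in>freqs K. freq_size \<kappa> powr (- 7 / 2)) \<le> S"
proof -
  obtain C where C: "0 \<le> C" "\<And>K. (\<Sum>l\<in>{- int K..int K}. max 1 \<bar>of_int l\<bar> powr (- (7 / 6 :: real))) \<le> C"
    using sum_max_powr_le [of "7 / 6"] by auto
  have "(\<Sum>\<kappa>\<in>freqs K. freq_size \<kappa> powr (- 7 / 2)) \<le> C ^ 3" for K
  proof -
    let ?f = "\<lambda>l::int. max 1 \<bar>of_int l\<bar> powr (- (7 / 6)) :: real"
    have "(\<Sum>\<kappa>\<in>freqs K. freq_size \<kappa> powr (- 7 / 2)) \<le> (\<Sum>(l, m, n)\<in>freqs K. ?f l * ?f m * ?f n)"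
    proof (rule sum_mono, clarify)
      fix l m n
      let ?J = "freq_size (l, m, n)"
      have mon: "?J powr (- (7 / 6)) \<le> ?f x" if "x \<in> {l, m, n}" for x
        using that by (intro powr_mono2') (auto simp: freq_size_def le_max_iff_disj)
      have "?J powr (- 7 / 2) = ?J powr (- (7 / 6)) * ?J powr (- (7 / 6)) * ?J powr (- (7 / 6))"
        by (simp flip: powr_add)
      also have "\<dots> \<le> ?f l * ?f m * ?f n"
        by (intro mult_mono mon) auto
      finally show "?J powr (- 7 / 2) \<le> ?f l * ?f m * ?f n" .
    qed
    also have "\<dots> = (\<Sum>l\<in>{- int K..int K}. ?f l) * (\<Sum>l\<in>{- int K..int K}. ?f l) * (\<Sum>l\<in>{- int K..int K}. ?f l)"
      unfolding freqs_def by (rule sum_Times3)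
    also have "\<dots> \<le> C ^ 3"
      using C unfolding power3_eq_cube by (intro mult_mono C) (auto intro!: sum_nonneg mult_nonneg_nonneg)
    finally show ?thesis .
  qed
  then show ?thesis using C(1) by (intro exI [of _ "C ^ 3"]) auto
qed

definition lattice_const :: real where
  "lattice_const = (SOME S. 0 \<le> S \<and> (\<forall>K. (\<Sum>\<kappa>\<in>freqs K. freq_size \<kappa> powr (- 7 / 2)) \<le> S))"

lemma lattice_const:
  "0 \<le> lattice_const" "(\<Sum>\<kappa>\<in>freqs K. freq_size \<kappa> powr (- 7 / 2)) \<le> lattice_const"
  using someI_ex [OF sum_freq_size_le [unfolded Bex_def]] unfolding lattice_const_def by blast+

text \<open>
  For the moduli of Fourier coefficients this is the square of a Sobolev norm of order \<open>e / 2\<close>.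
\<close>

definition wsum :: "nat \<Rightarrow> real \<Rightarrow> (index \<Rightarrow> real) \<Rightarrow> real" where
  "wsum K e A = (\<Sum>\<kappa>\<in>freqs K. freq_size \<kappa> powr e * (A \<kappa>)\<^sup>2)"

lemma wsum_nonneg [simp]: "0 \<le> wsum K e A"
  unfolding wsum_def by (intro sum_nonneg) auto

lemma wsum_0: "wsum K 0 A = (\<Sum>\<kappa>\<in>freqs K. (A \<kappa>)\<^sup>2)"
  by (simp add: wsum_def)

lemma wsum_mono:
  assumes "d \<le> e" "\<And>\<kappa>. \<kappa> \<in> freqs K \<Longrightarrow> \<bar>A \<kappa>\<bar> \<le> B \<kappa>"
  shows "wsum K d A \<le> wsum K e B"
  unfolding wsum_def
proof (intro sum_mono mult_mono)
  fix \<kappa> assume k: "\<kappa> \<in> freqs K"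
  show "freq_size \<kappa> powr d \<le> freq_size \<kappa> powr e"
    using assms(1) freq_size_ge_1 by (intro powr_mono) auto
  show "(A \<kappa>)\<^sup>2 \<le> (B \<kappa>)\<^sup>2"
    using assms(2) [OF k] power_mono [of "\<bar>A \<kappa>\<bar>" "B \<kappa>" 2] by simp
qed auto

lemma wsum_scale: "wsum K e (\<lambda>\<kappa>. c * A \<kappa>) = c\<^sup>2 * wsum K e A"
  by (simp add: wsum_def power_mult_distrib sum_distrib_left mult_ac)

lemma wsum_weight: "wsum K e (\<lambda>\<kappa>. freq_size \<kappa> powr d * A \<kappa>) = wsum K (2 * d + e) A"
  by (simp add: wsum_def power_mult_distrib powr_add powr_power mult_ac)

lemma wsum_add_le: "wsum K e (\<lambda>\<kappa>. A \<kappa> + B \<kappa>) \<le> 2 * wsum K e A + 2 * wsum K e B"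
proof -
  have "freq_size \<kappa> powr e * (A \<kappa> + B \<kappa>)\<^sup>2 \<le>
      2 * (freq_size \<kappa> powr e * (A \<kappa>)\<^sup>2) + 2 * (freq_size \<kappa> powr e * (B \<kappa>)\<^sup>2)" for \<kappa>
  proof -
    have "(A \<kappa> + B \<kappa>)\<^sup>2 \<le> 2 * (A \<kappa>)\<^sup>2 + 2 * (B \<kappa>)\<^sup>2"
      using zero_le_power2 [of "A \<kappa> - B \<kappa>"] by (simp add: power2_eq_square algebra_simps)
    from mult_left_mono [OF this, of "freq_size \<kappa> powr e"] show ?thesis by (simp add: algebra_simps)
  qed
  then show ?thesis
    unfolding wsum_def sum_distrib_left sum.distrib [symmetric] by (intro sum_mono)
qed

text \<open>
  The product estimate \<open>H^s \<cdot> H^t \<subseteq> L^2\<close> for \<open>s + t > 3 / 2\<close>, with a constant independent of the grid.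
  After the weights are inserted, the Cauchy-Schwarz inequality leaves the sum of
  \<open>freq_size \<eta> powr - d * freq_size (\<kappa> - \<eta>) powr - e\<close>. This is bounded by the lattice constant, because the
  smaller of the two sizes alone can be given the full exponent \<open>d + e\<close>.
\<close>

lemma wsum_cconv_le:
  assumes "0 \<le> d" "0 \<le> e" "7 / 2 \<le> d + e"
  shows "wsum K 0 (cconv K A B) \<le> 2 * lattice_const * wsum K d A * wsum K e B"
proof -
  let ?J = freq_size
  let ?r = "\<lambda>\<kappa> \<eta>. fold_freq K (\<kappa> - \<eta>)"
  define P where "P \<kappa> \<eta> = ?J \<eta> powr d * (A \<eta>)\<^sup>2 * (?J (?r \<kappa> \<eta>) powr e * (B (?r \<kappa> \<eta>))\<^sup>2)" for \<kappa> \<eta>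
  have wt: "x powr (- d) * y powr (- e) \<le> x powr (- 7 / 2) + y powr (- 7 / 2)"
    if "1 \<le> x" "1 \<le> y" for x y :: real
  proof -
    \<comment> \<open>Both factors are largest when both arguments are replaced by the smaller one.\<close>
    define t where "t = min x y"
    have t: "1 \<le> t" "t \<le> x" "t \<le> y" using that by (auto simp: t_def)
    have "x powr (- d) * y powr (- e) \<le> t powr (- d) * t powr (- e)"
      using t that assms by (intro mult_mono powr_mono2') auto
    also have "\<dots> \<le> t powr (- 7 / 2)"
      using t assms by (auto simp flip: powr_add intro!: powr_mono)
    also have "\<dots> \<le> x powr (- 7 / 2) + y powr (- 7 / 2)"
      by (auto simp: t_def min_def)
    finally show ?thesis .
  qed
  have L: "(\<Sum>\<eta>\<in>freqs K. ?J \<eta> powr (- d) * ?J (?r \<kappa> \<eta>) powr (- e)) \<le> 2 * lattice_const" for \<kappa>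
  proof -
    have "(\<Sum>\<eta>\<in>freqs K. ?J \<eta> powr (- d) * ?J (?r \<kappa> \<eta>) powr (- e)) \<le>
        (\<Sum>\<eta>\<in>freqs K. ?J \<eta> powr (- 7 / 2) + ?J (?r \<kappa> \<eta>) powr (- 7 / 2))"
      by (intro sum_mono wt freq_size_ge_1)
    also have "\<dots> = 2 * (\<Sum>\<eta>\<in>freqs K. ?J \<eta> powr (- 7 / 2))"
      unfolding sum.distrib sum_freqs_reflect [where h = "\<lambda>\<eta>. ?J \<eta> powr (- 7 / 2)"] by simp
    finally show ?thesis using lattice_const(2) [of K] by simp
  qed
  have cs: "(cconv K A B \<kappa>)\<^sup>2 \<le> 2 * lattice_const * (\<Sum>\<eta>\<in>freqs K. P \<kappa> \<eta>)" for \<kappa>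
  proof -
    define u where "u \<eta> = ?J \<eta> powr (d / 2) * A \<eta> * (?J (?r \<kappa> \<eta>) powr (e / 2) * B (?r \<kappa> \<eta>))" for \<eta>
    define v where "v \<eta> = ?J \<eta> powr (- d / 2) * ?J (?r \<kappa> \<eta>) powr (- e / 2)" for \<eta>
    have uv: "u \<eta> * v \<eta> = A \<eta> * B (?r \<kappa> \<eta>)" for \<eta>
    proof -
      have "u \<eta> * v \<eta> = (?J \<eta> powr (d / 2) * ?J \<eta> powr (- d / 2)) *
          (?J (?r \<kappa> \<eta>) powr (e / 2) * ?J (?r \<kappa> \<eta>) powr (- e / 2)) * (A \<eta> * B (?r \<kappa> \<eta>))"
        by (simp add: u_def v_def mult_ac)
      then show ?thesis by (simp flip: powr_add)
    qed
    have u2: "(u \<eta>)\<^sup>2 = P \<kappa> \<eta>" and v2: "(v \<eta>)\<^sup>2 = ?J \<eta> powr (- d) * ?J (?r \<kappa> \<eta>) powr (- e)" for \<eta>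
      by (simp_all add: u_def v_def P_def power_mult_distrib powr_power mult_ac)
    have "(cconv K A B \<kappa>)\<^sup>2 = (\<Sum>\<eta>\<in>freqs K. u \<eta> * v \<eta>)\<^sup>2"
      by (simp add: cconv_def uv)
    also have "\<dots> \<le> (\<Sum>\<eta>\<in>freqs K. (u \<eta>)\<^sup>2) * (\<Sum>\<eta>\<in>freqs K. (v \<eta>)\<^sup>2)"
      by (rule Cauchy_Schwarz_ineq_sum)
    also have "\<dots> \<le> (\<Sum>\<eta>\<in>freqs K. P \<kappa> \<eta>) * (2 * lattice_const)"
      unfolding u2 v2 by (intro mult_left_mono L sum_nonneg) (auto simp: P_def)
    finally show ?thesis by (simp add: mult_ac)
  qed
  have "wsum K 0 (cconv K A B) \<le> (\<Sum>\<kappa>\<in>freqs K. 2 * lattice_const * (\<Sum>\<eta>\<in>freqs K. P \<kappa> \<eta>))"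
    unfolding wsum_0 by (intro sum_mono cs)
  also have "\<dots> = 2 * lattice_const * (\<Sum>\<eta>\<in>freqs K. \<Sum>\<kappa>\<in>freqs K. P \<kappa> \<eta>)"
    by (subst sum.swap) (simp add: sum_distrib_left)
  also have "(\<Sum>\<eta>\<in>freqs K. \<Sum>\<kappa>\<in>freqs K. P \<kappa> \<eta>) = wsum K d A * wsum K e B"
    unfolding P_def sum_distrib_left [symmetric]
      sum_freqs_shift [where h = "\<lambda>\<kappa>. ?J \<kappa> powr e * (B \<kappa>)\<^sup>2"]
    by (simp add: wsum_def sum_distrib_right)
  finally show ?thesis by (simp add: mult.assoc)
qed

lemma cconv_sup_le:
  "(cconv K A B \<kappa>)\<^sup>2 \<le> wsum K 0 A * wsum K 0 B"
  unfolding cconv_def wsum_0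
  using Cauchy_Schwarz_ineq_sum [of A "\<lambda>\<eta>. B (fold_freq K (\<kappa> - \<eta>))" "freqs K"]
  by (simp add: sum_freqs_reflect [where h = "\<lambda>\<eta>. (B \<eta>)\<^sup>2"])

text \<open>
  The Leibniz rule puts the additional derivative on one factor, which is then square summable. By the
  Cauchy-Schwarz inequality it pairs with the product of the other two factors, whose square sum is bounded by the
  product estimate with \<open>d = e = 2\<close>.
\<close>

lemma cconv_cube_sup_le:
  assumes A: "\<And>\<kappa>. 0 \<le> A \<kappa>" and k: "\<kappa> \<in> freqs K"
  shows "freq_size \<kappa> * cconv_cube K A \<kappa> \<le> 3 * sqrt (2 * lattice_const * wsum K 2 A ^ 3)"
proof -
  let ?J = freq_size
  define P where "P = (\<lambda>\<kappa>. ?J \<kappa> * A \<kappa>)"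
  have P: "0 \<le> P \<kappa>" for \<kappa> using A by (simp add: P_def)
  have leib: "?J \<kappa> * cconv K A B \<kappa> \<le> cconv K P B \<kappa> + cconv K A (\<lambda>\<eta>. ?J \<eta> * B \<eta>) \<kappa>"
    if "\<And>\<eta>. 0 \<le> B \<eta>" "\<kappa> \<in> freqs K" for B \<kappa>
  proof -
    have "?J \<kappa> * (A \<eta> * B (fold_freq K (\<kappa> - \<eta>))) \<le>
        (?J \<eta> + ?J (fold_freq K (\<kappa> - \<eta>))) * (A \<eta> * B (fold_freq K (\<kappa> - \<eta>)))" for \<eta>
      using that A by (intro mult_right_mono freq_size_triangle) auto
    then show ?thesis
      unfolding cconv_def sum_distrib_left sum.distrib [symmetric]
      by (intro sum_mono) (simp add: P_def algebra_simps)
  qed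
  have AA: "0 \<le> cconv K A A \<eta>" for \<eta> by (intro cconv_nonneg A)
  have two: "?J \<eta> * cconv K A A \<eta> \<le> cconv K P A \<eta> + cconv K A P \<eta>" if "\<eta> \<in> freqs K" for \<eta>
    using leib [OF A that] by (simp add: P_def)
  have "?J \<kappa> * cconv K A (cconv K A A) \<kappa> \<le>
      cconv K P (cconv K A A) \<kappa> + cconv K A (\<lambda>\<eta>. ?J \<eta> * cconv K A A \<eta>) \<kappa>"
    by (rule leib [OF AA k])
  also have "cconv K A (\<lambda>\<eta>. ?J \<eta> * cconv K A A \<eta>) \<kappa> \<le> cconv K A (\<lambda>\<eta>. 2 * cconv K P A \<eta>) \<kappa>"
    using two cconv_commute [of _ K A P]
    by (intro cconv_mono) (auto simp: A AA)
  also have "\<dots> = 2 * cconv K P (cconv K A A) \<kappa>"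
    by (simp add: cconv_scale cconv_left_commute [of K A P])
  finally have "?J \<kappa> * cconv_cube K A \<kappa> \<le> 3 * cconv K P (cconv K A A) \<kappa>"
    by (simp add: cconv_cube_def)
  also have "cconv K P (cconv K A A) \<kappa> \<le> sqrt (2 * lattice_const * wsum K 2 A ^ 3)"
  proof (rule real_le_rsqrt)
    have P2: "wsum K 0 P = wsum K 2 A"
      using wsum_weight [of K 0 1 A] by (simp add: P_def)
    have "(cconv K P (cconv K A A) \<kappa>)\<^sup>2 \<le> wsum K 0 P * wsum K 0 (cconv K A A)"
      by (rule cconv_sup_le)
    also have "\<dots> \<le> wsum K 2 A * (2 * lattice_const * wsum K 2 A * wsum K 2 A)"
      unfolding P2 by (intro mult_left_mono wsum_cconv_le) auto
    finally show "(cconv K P (cconv K A A) \<kappa>)\<^sup>2 \<le> 2 * lattice_const * wsum K 2 A ^ 3"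
      by (simp add: power3_eq_cube mult_ac)
  qed
  finally show ?thesis by simp
qed

text \<open>
  The trilinear estimate behind the last step of the bootstrap. It uses the product estimate twice, with
  exponents \<open>5 / 2 + 1\<close> and \<open>3 / 2 + 5 / 2\<close>; half a derivative is spread over the inner product in between.
\<close>

lemma wsum_cconv_cube_le:
  assumes A: "\<And>\<kappa>. 0 \<le> A \<kappa>"
  shows "wsum K 0 (cconv_cube K A) \<le> 16 * lattice_const\<^sup>2 * wsum K (5 / 2) A ^ 3"
proof -
  let ?J = freq_size
  let ?w = "wsum K (5 / 2) A"
  define H where "H = (\<lambda>\<kappa>. ?J \<kappa> powr (1 / 2) * A \<kappa>)"
  have H: "0 \<le> H \<kappa>" for \<kappa> using A by (simp add: H_def)
  have half: "?J \<kappa> powr (1 / 2) * cconv K A A \<kappa> \<le> 2 * cconv K H A \<kappa>" if k: "\<kappa> \<in> freqs K" for \<kappa>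
  proof -
    have "?J \<kappa> powr (1 / 2) * (A \<eta> * A (fold_freq K (\<kappa> - \<eta>))) \<le>
        (?J \<eta> powr (1 / 2) + ?J (fold_freq K (\<kappa> - \<eta>)) powr (1 / 2)) * (A \<eta> * A (fold_freq K (\<kappa> - \<eta>)))" for \<eta>
    proof (intro mult_right_mono mult_nonneg_nonneg A)
      have "?J \<kappa> powr (1 / 2) \<le> sqrt (?J \<eta> + ?J (fold_freq K (\<kappa> - \<eta>)))"
        using freq_size_triangle [OF k, of \<eta>] by (simp add: powr_half_sqrt)
      also have "\<dots> \<le> ?J \<eta> powr (1 / 2) + ?J (fold_freq K (\<kappa> - \<eta>)) powr (1 / 2)"
        using sqrt_add_le_add_sqrt by (simp add: powr_half_sqrt)
      finally show "?J \<kappa> powr (1 / 2) \<le> ?J \<eta> powr (1 / 2) + ?J (fold_freq K (\<kappa> - \<eta>)) powr (1 / 2)" .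
    qed
    then have "?J \<kappa> powr (1 / 2) * cconv K A A \<kappa> \<le> cconv K H A \<kappa> + cconv K A H \<kappa>"
      unfolding cconv_def sum_distrib_left sum.distrib [symmetric]
      by (intro sum_mono) (simp add: H_def algebra_simps)
    then show ?thesis using cconv_commute [OF k, of A H] by simp
  qed
  have "wsum K 1 (cconv K A A) = wsum K 0 (\<lambda>\<kappa>. ?J \<kappa> powr (1 / 2) * cconv K A A \<kappa>)"
    by (simp add: wsum_weight)
  also have "\<dots> \<le> wsum K 0 (\<lambda>\<kappa>. 2 * cconv K H A \<kappa>)"
    using half by (intro wsum_mono) (auto simp: abs_mult cconv_nonneg A)
  also have "\<dots> = 4 * wsum K 0 (cconv K H A)" by (simp add: wsum_scale)
  also have "wsum K 0 (cconv K H A) \<le> 2 * lattice_const * wsum K (3 / 2) H * ?w"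
    by (rule wsum_cconv_le) auto
  also have "wsum K (3 / 2) H = ?w" by (simp add: H_def wsum_weight)
  finally have one: "wsum K 1 (cconv K A A) \<le> 8 * lattice_const * (?w * ?w)" by simp
  have "wsum K 0 (cconv K A (cconv K A A)) \<le> 2 * lattice_const * ?w * wsum K 1 (cconv K A A)"
    by (rule wsum_cconv_le) auto
  also have "\<dots> \<le> 2 * lattice_const * ?w * (8 * lattice_const * (?w * ?w))"
    using lattice_const(1) by (intro mult_left_mono one mult_nonneg_nonneg) auto
  finally show ?thesis by (simp add: cconv_cube_def power3_eq_cube power2_eq_square mult_ac)
qed

section \<open>One Fourier mode of the BDF2 recursion\<close>

text \<open>
  This identity makes the two-step backward differentiation formula G-stable.
\<close>

lemma bdf2_identity:
  fixes x y w :: complex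
  shows "4 * Re (cnj x * (3 / 2 * x - 2 * y + 1 / 2 * w)) =
    (norm x)\<^sup>2 + (norm (2 * x - y))\<^sup>2 - (norm y)\<^sup>2 - (norm (2 * y - w))\<^sup>2 + (norm (x - 2 * y + w))\<^sup>2"
  unfolding cmod_power2 by (simp add: power2_eq_square field_simps)

text \<open>
  This replaces the smoothing property of the semigroup. Each mode stays below its initial values plus
  the supremum in time of the rescaled forcing \<open>f\<close>, with a constant that does not depend on \<open>z \<ge> 0\<close>, hence neither
  on the step size nor on the wave vector. Two regimes are needed: for large \<open>z\<close> the implicit term alone dominates
  the recursion, for bounded \<open>z\<close> the quadratic form of the preceding identity decreases as soon as it is large.
\<close>

lemma bdf2_mode_bound:
  fixes u f :: "nat \<Rightarrow> complex" and z q :: real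
  assumes rec: "\<And>n. (3 / 2 + of_real z) * u (n + 2) = 2 * u (n + 1) - 1 / 2 * u n + of_real z * f n"
    and f: "\<And>n. norm (f n) \<le> q" and z: "0 \<le> z" and q: "0 \<le> q"
  shows "norm (u n) \<le> 5 * (norm (u 0) + norm (u 1) + q)"
proof (cases "z \<le> 2")
  case False
  define B where "B = norm (u 0) + norm (u 1) + 2 * q"
  have B: "2 * q \<le> B" "0 \<le> B" using q by (auto simp: B_def)
  have "norm (u n) \<le> B \<and> norm (u (n + 1)) \<le> B"
  proof (induction n)
    case 0 then show ?case using q by (auto simp: B_def)
  next
    case (Suc n)
    have "(3 / 2 + z) * norm (u (n + 2)) = norm ((3 / 2 + of_real z) * u (n + 2))"
      using z norm_of_real [of "3 / 2 + z", where 'a = complex] by (simp add: norm_mult)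
    also have "\<dots> \<le> norm (2 * u (n + 1)) + norm (1 / 2 * u n) + norm (of_real z * f n)"
      unfolding rec using norm_triangle_ineq [of "2 * u (n + 1) - 1 / 2 * u n" "of_real z * f n"]
        norm_triangle_ineq4 [of "2 * u (n + 1)" "1 / 2 * u n"] by linarith
    also have "\<dots> \<le> 2 * B + 1 / 2 * B + z * q"
      using Suc f [of n] z by (auto simp: norm_mult norm_divide intro!: add_mono mult_left_mono)
    also have "\<dots> \<le> (3 / 2 + z) * B"
    proof -
      have "z * q \<le> z * (B / 2)" using B z by (intro mult_left_mono) auto
      moreover have "2 * B \<le> z * B" using False B by (intro mult_right_mono) auto
      ultimately show ?thesis by (simp add: algebra_simps)
    qed
    finally have "norm (u (n + 2)) \<le> B" using z by simp
    with Suc show ?case by simp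
  qed
  then show ?thesis unfolding B_def using q by (smt (verit) norm_ge_zero)
next
  case True
  \<comment> \<open>The G-norm of two consecutive values, plus a part of the damping so that the decay can be absorbed.\<close>
  define W where "W n = (norm (u (n + 1)))\<^sup>2 + (norm (2 * u (n + 1) - u n))\<^sup>2 + z * (norm (u (n + 1)))\<^sup>2" for n
  define B where "B = 25 * (norm (u 0) + norm (u 1) + q)\<^sup>2"
  have tri: "(norm (2 * x - y))\<^sup>2 \<le> 8 * (norm x)\<^sup>2 + 2 * (norm y)\<^sup>2" for x y :: complex
  proof -
    have "(norm (2 * x - y))\<^sup>2 + (norm (2 * x + y))\<^sup>2 = 8 * (norm x)\<^sup>2 + 2 * (norm y)\<^sup>2"
      by (simp only: cmod_power2) (simp add: power2_eq_square algebra_simps)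
    then show ?thesis by (smt (verit) zero_le_power2)
  qed
  have step: "W (n + 1) + z * (norm (u (n + 2)))\<^sup>2 + z * (norm (u (n + 1)))\<^sup>2 \<le> W n + 2 * z * q\<^sup>2" for n
  proof -
    let ?x = "u (n + 2)" and ?y = "u (n + 1)" and ?w = "u n"
    note id = bdf2_identity [of ?x ?y ?w]
    have "3 / 2 * ?x - 2 * ?y + 1 / 2 * ?w = of_real z * (f n - ?x)"
      using rec [of n] by (simp add: algebra_simps)
    then have "4 * Re (cnj ?x * (3 / 2 * ?x - 2 * ?y + 1 / 2 * ?w)) = 4 * z * (Re (cnj ?x * f n) - (norm ?x)\<^sup>2)"
      by (simp only: cmod_power2) (simp add: power2_eq_square algebra_simps)
    also have "\<dots> \<le> 4 * z * (q\<^sup>2 / 2 - (norm ?x)\<^sup>2 / 2)"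
    proof (intro mult_left_mono)
      have "Re (cnj ?x * f n) \<le> norm ?x * norm (f n)"
        by (metis complex_Re_le_cmod complex_mod_cnj norm_mult)
      also have "\<dots> \<le> norm ?x * q" using f by (intro mult_left_mono) auto
      also have "\<dots> \<le> q\<^sup>2 / 2 + (norm ?x)\<^sup>2 / 2"
        using zero_le_power2 [of "norm ?x - q"] by (simp add: power2_eq_square algebra_simps)
      finally show "Re (cnj ?x * f n) - (norm ?x)\<^sup>2 \<le> q\<^sup>2 / 2 - (norm ?x)\<^sup>2 / 2" by simp
    qed (use z in auto)
    also have "\<dots> = 2 * z * q\<^sup>2 - 2 * (z * (norm ?x)\<^sup>2)" by (simp add: algebra_simps)
    finally have upper: "4 * Re (cnj ?x * (3 / 2 * ?x - 2 * ?y + 1 / 2 * ?w)) \<le> 2 * z * q\<^sup>2 - 2 * (z * (norm ?x)\<^sup>2)" .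
    have "W (n + 1) = (norm ?x)\<^sup>2 + (norm (2 * ?x - ?y))\<^sup>2 + z * (norm ?x)\<^sup>2"
      by (simp add: W_def)
    moreover have "W n = (norm ?y)\<^sup>2 + (norm (2 * ?y - ?w))\<^sup>2 + z * (norm ?y)\<^sup>2"
      by (simp add: W_def)
    ultimately show ?thesis
      using upper id zero_le_power2 [of "norm (?x - 2 * ?y + ?w)"] by linarith
  qed
  have WB: "W n \<le> B" for n
  proof (induction n)
    case 0
    let ?s = "norm (u 0) + norm (u 1) + q"
    have "(norm (u 0))\<^sup>2 \<le> ?s\<^sup>2" "(norm (u 1))\<^sup>2 \<le> ?s\<^sup>2" using q by (auto intro!: power_mono)
    moreover have "W 0 = (norm (u 1))\<^sup>2 + (norm (2 * u 1 - u 0))\<^sup>2 + z * (norm (u 1))\<^sup>2"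
      by (simp add: W_def)
    moreover have "z * (norm (u 1))\<^sup>2 \<le> 2 * (norm (u 1))\<^sup>2" using True by (intro mult_right_mono) auto
    ultimately show ?case using tri [of "u 1" "u 0"] zero_le_power2 [of ?s] unfolding B_def by linarith
  next
    case (Suc n)
    show ?case
    proof (rule ccontr)
      assume less: "\<not> W (Suc n) \<le> B"
      have "11 * ((norm (u (n + 2)))\<^sup>2 + (norm (u (n + 1)))\<^sup>2) \<ge> W (n + 1)"
      proof -
        have "W (n + 1) = (norm (u (n + 2)))\<^sup>2 + (norm (2 * u (n + 2) - u (n + 1)))\<^sup>2 + z * (norm (u (n + 2)))\<^sup>2"
          by (simp add: W_def)
        moreover have "z * (norm (u (n + 2)))\<^sup>2 \<le> 2 * (norm (u (n + 2)))\<^sup>2"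
          using True by (intro mult_right_mono) auto
        ultimately show ?thesis
          using tri [of "u (n + 2)" "u (n + 1)"] zero_le_power2 [of "norm (u (n + 1))"] by argo
      qed
      then have "z * (B / 11) \<le> z * ((norm (u (n + 2)))\<^sup>2 + (norm (u (n + 1)))\<^sup>2)"
        using less z by (intro mult_left_mono) auto
      moreover have "z * (2 * q\<^sup>2) \<le> z * (B / 11)"
      proof (intro mult_left_mono z)
        have "q\<^sup>2 \<le> (norm (u 0) + norm (u 1) + q)\<^sup>2" using q by (intro power_mono) auto
        then show "2 * q\<^sup>2 \<le> B / 11"
          using zero_le_power2 [of "norm (u 0) + norm (u 1) + q"] unfolding B_def by linarith
      qed
      ultimately have "W (n + 1) \<le> W n" using step [of n] by (simp add: algebra_simps)
      with Suc less show False by simp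
    qed
  qed
  have succ: "norm (u (n + 1)) \<le> 5 * (norm (u 0) + norm (u 1) + q)" for n
  proof (rule power2_le_imp_le)
    have "(norm (u (n + 1)))\<^sup>2 \<le> W n" using z by (simp add: W_def)
    also note WB [of n]
    finally show "(norm (u (n + 1)))\<^sup>2 \<le> (5 * (norm (u 0) + norm (u 1) + q))\<^sup>2"
      unfolding B_def power_mult_distrib [of 5] by simp
  qed (use q in simp)
  show ?thesis
    using succ [of "n - 1"] q by (cases n) auto
qed

section \<open>The Sobolev norm of a trigonometric polynomial\<close>

definition trig_poly :: "nat \<Rightarrow> (index \<Rightarrow> complex) \<Rightarrow> real ^ 3 \<Rightarrow> complex" where
  "trig_poly K c x = (\<Sum>\<kappa>\<in>freqs K. c \<kappa> * wave \<kappa> x)"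

lemma wave_axis:
  "wave \<kappa> (x + t *\<^sub>R axis i 1) = exp (of_real t * (2 * of_real pi * \<i> * of_int (wave_comp i \<kappa>))) * wave \<kappa> x"
proof -
  obtain l m n where k: "\<kappa> = (l, m, n)" by (cases \<kappa>)
  have "of_int l * (x + t *\<^sub>R axis i 1) $ 1 + of_int m * (x + t *\<^sub>R axis i 1) $ 2 + of_int n * (x + t *\<^sub>R axis i 1) $ 3
    = t * of_int (wave_comp i \<kappa>) + (of_int l * x $ 1 + of_int m * x $ 2 + of_int n * x $ 3)"
    using exhaust_3 [of i] by (auto simp: k wave_comp_def axis_def algebra_simps)
  then show ?thesis
    unfolding k wave_def split_conv exp_add [symmetric]
    by (simp only: of_real_add of_real_mult of_real_of_int_eq) (simp add: algebra_simps)
qed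

lemma partial_deriv_trig_poly:
  "partial_deriv i (trig_poly K c) = trig_poly K (\<lambda>\<kappa>. 2 * of_real pi * \<i> * of_int (wave_comp i \<kappa>) * c \<kappa>)"
proof
  fix x
  have "((\<lambda>t. \<Sum>\<kappa>\<in>freqs K. c \<kappa> * (exp (of_real t * (2 * of_real pi * \<i> * of_int (wave_comp i \<kappa>))) * wave \<kappa> x))
      has_vector_derivative (\<Sum>\<kappa>\<in>freqs K. 2 * of_real pi * \<i> * of_int (wave_comp i \<kappa>) * c \<kappa> * wave \<kappa> x)) (at 0)"
  proof (rule has_vector_derivative_sum)
    fix \<kappa>
    let ?d = "2 * of_real pi * \<i> * of_int (wave_comp i \<kappa>) :: complex"
    have "((\<lambda>t. c \<kappa> * (exp (t * ?d) * wave \<kappa> x)) has_field_derivative ?d * c \<kappa> * wave \<kappa> x) (at (of_real 0))"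
      by (auto intro!: derivative_eq_intros)
    from has_vector_derivative_real_field [OF this]
    show "((\<lambda>t. c \<kappa> * (exp (of_real t * ?d) * wave \<kappa> x)) has_vector_derivative ?d * c \<kappa> * wave \<kappa> x) (at 0)" .
  qed
  from vector_derivative_at [OF this]
  show "partial_deriv i (trig_poly K c) x = trig_poly K (\<lambda>\<kappa>. 2 * of_real pi * \<i> * of_int (wave_comp i \<kappa>) * c \<kappa>) x"
    by (simp add: partial_deriv_def trig_poly_def wave_axis)
qed

lemma iterated_partial_deriv_trig_poly:
  "(partial_deriv i ^^ \<alpha>) (trig_poly K c) =
     trig_poly K (\<lambda>\<kappa>. (2 * of_real pi * \<i> * of_int (wave_comp i \<kappa>)) ^ \<alpha> * c \<kappa>)"
  by (induction \<alpha>) (simp_all add: partial_deriv_trig_poly mult.assoc)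

lemma integral_exp_unit_interval:
  "(\<integral>t. indicator {0<..<1} t *\<^sub>R exp (2 * of_real pi * \<i> * of_int l * of_real t) \<partial>lborel) = (if l = 0 then 1 else 0 :: complex)"
proof (cases "l = 0")
  case False
  let ?d = "2 * of_real pi * \<i> * of_int l :: complex"
  have d: "?d \<noteq> 0" using False by simp
  have "(LBINT t=0..1. exp (?d * of_real t)) = exp (?d * of_real 1) / ?d - exp (?d * of_real 0) / ?d"
    unfolding zero_ereal_def one_ereal_def
  proof (rule interval_integral_FTC_finite)
    show "continuous_on {min 0 1..max 0 (1::real)} (\<lambda>t. exp (?d * of_real t))"
      by (intro continuous_intros)
    fix x :: real
    have "((\<lambda>t. exp (?d * t) / ?d) has_field_derivative exp (?d * of_real x)) (at (of_real x))"
      using d by (auto intro!: derivative_eq_intros)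
    from has_vector_derivative_real_field [OF this]
    show "((\<lambda>t. exp (?d * of_real t) / ?d) has_vector_derivative exp (?d * of_real x)) (at x within {min 0 1..max 0 1})"
      by (rule has_vector_derivative_at_within)
  qed
  also have "exp (?d * of_real 1) = 1"
    by (simp add: exp_eq_1 mult_ac)
  finally have "(LBINT t=0..1. exp (?d * of_real t)) = 0" by simp
  moreover have "einterval 0 1 = {0<..<1}"
    by (auto simp: einterval_def)
  ultimately show ?thesis
    using False by (simp add: interval_lebesgue_integral_def set_lebesgue_integral_def)
qed simp

lemma integrable_exp_unit_interval:
  "integrable lborel (\<lambda>t. indicator {0<..<1} t *\<^sub>R exp (2 * of_real pi * \<i> * of_int l * of_real t) :: complex)"
proof (rule Bochner_Integration.integrable_bound [where f = "indicator {0<..<1::real} :: real \<Rightarrow> real"])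
  have "norm (exp (2 * of_real pi * \<i> * of_int l * of_real t)) = 1" for t :: real
    by (simp add: norm_exp_eq_Re)
  then show "AE t in lborel. norm (indicator {0<..<1} t *\<^sub>R exp (2 * of_real pi * \<i> * of_int l * of_real t) :: complex)
      \<le> norm (indicator {0<..<1} t :: real)"
    by (intro AE_I2) (simp add: indicator_def)
qed (auto simp: integrable_indicator_iff)

lemma unit_cube_eq_box: "unit_cube = box 0 (\<Sum>b\<in>Basis. b)"
proof -
  have "(\<Sum>b\<in>Basis. b :: real ^ 3) $ i = 1" for i
    using inner_sum_left_Basis [of "axis i 1 :: real ^ 3" "\<lambda>_. 1"]
    by (simp only: cart_eq_inner_axis) (simp add: axis_in_Basis_iff)
  then show ?thesis
    by (auto simp: unit_cube_def mem_box_cart simp del: sum_component)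
qed

lemma unit_cube_borel: "unit_cube \<in> sets borel"
  by (simp add: unit_cube_eq_box)

lemma emeasure_unit_cube: "emeasure lborel unit_cube = 1"
  unfolding unit_cube_eq_box by (subst emeasure_lborel_box) (use inner_sum_left_Basis [of _ "\<lambda>_. 1"] in auto)

lemma wave_borel: "wave \<kappa> \<in> borel_measurable borel"
  by (intro borel_measurable_continuous_onI) (cases \<kappa>, auto simp: wave_def intro!: continuous_intros)

text \<open>
  On the unit cube the integral is a product of three one-dimensional integrals over a full period.
\<close>

lemma integral_wave:
  "(\<integral>x. indicator unit_cube x *\<^sub>R wave \<kappa> x \<partial>lborel) = (if \<kappa> = 0 then 1 else 0)"
proof -
  interpret product_sigma_finite "\<lambda>b :: real ^ 3. lborel :: real measure" ..
  define c where "c b = wave_comp (THE i. b = axis i 1) \<kappa>" for b :: "real ^ 3"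
  let ?g = "\<lambda>b t. indicator {0<..<1} t *\<^sub>R exp (2 * of_real pi * \<i> * of_int (c b) * of_real t) :: complex"
  have c: "c (axis i 1) = wave_comp i \<kappa>" for i
    unfolding c_def by (rule arg_cong2 [where f = wave_comp]) (auto simp: axis_eq_axis)
  have Basis: "(Basis :: (real ^ 3) set) = range (\<lambda>i. axis i 1)" by (auto simp: Basis_vec_def)
  have inj: "inj (\<lambda>i. axis i 1 :: real ^ 3)" by (auto simp: inj_on_def axis_eq_axis)
  let ?s = "\<lambda>f. \<Sum>b\<in>Basis. f b *\<^sub>R b :: real ^ 3"
  have nth: "?s f $ i = f (axis i 1)" for f i
    unfolding Basis sum.reindex [OF inj] by (simp add: sum_component axis_def if_distrib cong: if_cong)
  have prod: "indicator unit_cube (?s f) *\<^sub>R wave \<kappa> (?s f) = (\<Prod>b\<in>Basis. ?g b (f b))" for f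
  proof -
    obtain l m n where k: "\<kappa> = (l, m, n)" by (cases \<kappa>)
    have "(\<Prod>b\<in>Basis. ?g b (f b)) = (\<Prod>i\<in>UNIV. indicator {0<..<1} (f (axis i 1)) *\<^sub>R
        exp (2 * of_real pi * \<i> * of_int (wave_comp i \<kappa>) * of_real (f (axis i 1))))"
      unfolding Basis prod.reindex [OF inj] by (simp add: c)
    also have "\<dots> = indicator unit_cube (?s f) *\<^sub>R wave \<kappa> (?s f)"
    proof -
      have "(\<Prod>i\<in>UNIV. indicator {0<..<1} (f (axis i 1)) *\<^sub>R
          exp (2 * of_real pi * \<i> * of_int (wave_comp i \<kappa>) * of_real (f (axis i 1)))) =
        indicator unit_cube y *\<^sub>R wave \<kappa> y" if y: "\<And>i. y $ i = f (axis i 1)" for y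
        unfolding UNIV_3
        by (simp add: k wave_comp_def wave_def y unit_cube_def forall_3 indicator_def exp_add [symmetric] algebra_simps)
      from this [OF nth] show ?thesis .
    qed
    finally show ?thesis ..
  qed
  have "(\<integral>x. indicator unit_cube x *\<^sub>R wave \<kappa> x \<partial>lborel) = (\<integral>f. (\<Prod>b\<in>Basis. ?g b (f b)) \<partial>(\<Pi>\<^sub>M b\<in>Basis. lborel))"
    by (subst lborel_eq, subst integral_distr) (auto simp: prod intro!: borel_measurable_scaleR borel_measurable_indicator unit_cube_borel wave_borel)
  also have "\<dots> = (\<Prod>b\<in>Basis. integral\<^sup>L lborel (?g b))"
    by (rule product_integral_prod) (auto intro: integrable_exp_unit_interval)
  also have "\<dots> = (\<Prod>b\<in>Basis. if c b = 0 then 1 else 0)"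
    by (simp only: integral_exp_unit_interval)
  also have "\<dots> = (if \<kappa> = 0 then 1 else 0)"
  proof -
    have "\<kappa> = 0 \<longleftrightarrow> (\<forall>i. wave_comp i \<kappa> = 0)"
      by (cases \<kappa>) (simp add: forall_3 wave_comp_def zero_prod_def)
    moreover have "(\<Prod>b\<in>Basis. if c b = 0 then 1 else 0 :: complex) = (\<Prod>i\<in>UNIV. if wave_comp i \<kappa> = 0 then 1 else 0)"
      unfolding Basis prod.reindex [OF inj] comp_def c by (rule refl)
    moreover have "\<dots> = (if \<forall>i. wave_comp i \<kappa> = 0 then 1 else 0)"
      by (auto intro!: prod_zero)
    ultimately show ?thesis by simp
  qed
  finally show ?thesis .
qed

lemma integrable_wave: "integrable lborel (\<lambda>x. indicator unit_cube x *\<^sub>R wave \<kappa> x)"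
proof (rule Bochner_Integration.integrable_bound [where f = "indicator unit_cube :: real ^ 3 \<Rightarrow> real"])
  show "integrable lborel (indicator unit_cube :: real ^ 3 \<Rightarrow> real)"
    using unit_cube_borel by (simp add: integrable_indicator_iff emeasure_unit_cube)
  show "(\<lambda>x. indicator unit_cube x *\<^sub>R wave \<kappa> x) \<in> borel_measurable lborel"
    using unit_cube_borel wave_borel by (auto intro!: borel_measurable_scaleR borel_measurable_indicator)
qed (auto simp: indicator_def)

lemma integral_trig_poly:
  "(LINT x:unit_cube|lborel. (norm (trig_poly K c x))\<^sup>2) = (\<Sum>\<kappa>\<in>freqs K. (norm (c \<kappa>))\<^sup>2)"
proof -
  define h where "h \<kappa> \<eta> x = c \<kappa> * cnj (c \<eta>) * (indicator unit_cube x *\<^sub>R wave (\<kappa> - \<eta>) x)" for \<kappa> \<eta> x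
  have h: "integrable lborel (h \<kappa> \<eta>)"
    "integral\<^sup>L lborel (h \<kappa> \<eta>) = c \<kappa> * cnj (c \<eta>) * (if \<kappa> = \<eta> then 1 else 0)" for \<kappa> \<eta>
    unfolding h_def by (intro integrable_mult_right integrable_wave)
      (simp only: integral_mult_right_zero integral_wave right_minus_eq)
  have "complex_of_real (indicator unit_cube x *\<^sub>R (norm (trig_poly K c x))\<^sup>2) =
      (\<Sum>\<kappa>\<in>freqs K. \<Sum>\<eta>\<in>freqs K. h \<kappa> \<eta> x)" for x
    unfolding of_real_mult real_scaleR_def complex_norm_square trig_poly_def cnj_sum sum_product h_def
    by (simp only: wave_diff sum_distrib_left scaleR_conv_of_real complex_cnj_mult mult_ac)
  then have "complex_of_real (LINT x:unit_cube|lborel. (norm (trig_poly K c x))\<^sup>2) =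
      (\<integral>x. (\<Sum>\<kappa>\<in>freqs K. \<Sum>\<eta>\<in>freqs K. h \<kappa> \<eta> x) \<partial>lborel)"
    unfolding set_lebesgue_integral_def integral_complex_of_real [symmetric] by (simp only:)
  also have "\<dots> = (\<Sum>\<kappa>\<in>freqs K. \<Sum>\<eta>\<in>freqs K. c \<kappa> * cnj (c \<eta>) * (if \<kappa> = \<eta> then 1 else 0))"
    by (simp add: Bochner_Integration.integral_sum h)
  also have "\<dots> = complex_of_real (\<Sum>\<kappa>\<in>freqs K. (norm (c \<kappa>))\<^sup>2)"
    by (simp add: if_distrib flip: complex_norm_square cong: if_cong)
  finally show ?thesis by (simp only: of_real_eq_iff)
qed

text \<open>
  Parseval turns each derivative of the interpolant into multiplication of the coefficients by a monomial.
\<close>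

lemma sobolev_norm_sq:
  "(sobolev_norm s (spectral_interp K f))\<^sup>2 =
     (\<Sum>(\<alpha>, \<beta>, \<gamma>)\<in>{(\<alpha>, \<beta>, \<gamma>). \<alpha> + \<beta> + \<gamma> \<le> s}. \<Sum>\<kappa>\<in>freqs K.
        ((2 * pi * \<bar>of_int (wave_comp 1 \<kappa>)\<bar>) ^ \<alpha> * (2 * pi * \<bar>of_int (wave_comp 2 \<kappa>)\<bar>) ^ \<beta> *
         (2 * pi * \<bar>of_int (wave_comp 3 \<kappa>)\<bar>) ^ \<gamma> * norm (dft K f \<kappa>))\<^sup>2)"
proof -
  have eq: "(LINT x:unit_cube|lborel. (norm ((partial_deriv 1 ^^ \<alpha>) ((partial_deriv 2 ^^ \<beta>)
        ((partial_deriv 3 ^^ \<gamma>) (spectral_interp K f))) x))\<^sup>2) =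
      (\<Sum>\<kappa>\<in>freqs K. ((2 * pi * \<bar>of_int (wave_comp 1 \<kappa>)\<bar>) ^ \<alpha> * (2 * pi * \<bar>of_int (wave_comp 2 \<kappa>)\<bar>) ^ \<beta> *
         (2 * pi * \<bar>of_int (wave_comp 3 \<kappa>)\<bar>) ^ \<gamma> * norm (dft K f \<kappa>))\<^sup>2)" for \<alpha> \<beta> \<gamma>
  proof -
    have "spectral_interp K f = trig_poly K (dft K f)"
      by (simp add: fun_eq_iff spectral_interp_def trig_poly_def)
    then show ?thesis
      by (simp only: iterated_partial_deriv_trig_poly integral_trig_poly)
        (simp add: norm_mult norm_power mult.assoc)
  qed
  show ?thesis
    unfolding sobolev_norm_def eq
    by (rule real_sqrt_pow2) (auto intro!: sum_nonneg)
qed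

lemma finite_multi_indices: "finite {(\<alpha>, \<beta>, \<gamma>). \<alpha> + \<beta> + \<gamma> \<le> (s :: nat)}"
  by (rule finite_subset [of _ "{..s} \<times> {..s} \<times> {..s}"]) auto

text \<open>
  The function itself and the three pure third derivatives already control the weight.
\<close>

lemma wsum_6_le_sobolev_norm:
  "wsum K 6 (\<lambda>\<kappa>. norm (dft K f \<kappa>)) \<le> (sobolev_norm 3 (spectral_interp K f))\<^sup>2"
proof -
  define X where "X i \<kappa> = 2 * pi * \<bar>of_int (wave_comp i \<kappa>)\<bar>" for i \<kappa>
  define T where "T = (\<lambda>(\<alpha>, \<beta>, \<gamma>) \<kappa>. (X 1 \<kappa> ^ \<alpha> * X 2 \<kappa> ^ \<beta> * X 3 \<kappa> ^ \<gamma> * norm (dft K f \<kappa>))\<^sup>2)"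
  let ?I = "{(0, 0, 0), (3, 0, 0), (0, 3, 0), (0, 0, 3 :: nat)} :: (nat \<times> nat \<times> nat) set"
  have le: "freq_size \<kappa> ^ 6 \<le> 1 + X 1 \<kappa> ^ 6 + X 2 \<kappa> ^ 6 + X 3 \<kappa> ^ 6" for \<kappa>
  proof -
    have X: "\<bar>of_int (wave_comp i \<kappa>)\<bar> ^ 6 \<le> X i \<kappa> ^ 6" for i
    proof (rule power_mono)
      have "1 \<le> 2 * pi" using pi_ge_two by linarith
      then show "\<bar>of_int (wave_comp i \<kappa>)\<bar> \<le> X i \<kappa>"
        unfolding X_def using mult_right_mono [of 1 "2 * pi" "\<bar>real_of_int (wave_comp i \<kappa>)\<bar>"] by simp
    qed simp
    obtain l m n where k: "\<kappa> = (l, m, n)" by (cases \<kappa>)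
    have "freq_size \<kappa> ^ 6 = 1 \<or> freq_size \<kappa> ^ 6 = \<bar>of_int (wave_comp 1 \<kappa>)\<bar> ^ 6 \<or>
        freq_size \<kappa> ^ 6 = \<bar>of_int (wave_comp 2 \<kappa>)\<bar> ^ 6 \<or> freq_size \<kappa> ^ 6 = \<bar>of_int (wave_comp 3 \<kappa>)\<bar> ^ 6"
      by (auto simp: k wave_comp_def freq_size_def max_def)
    moreover have "0 \<le> X i \<kappa> ^ 6" for i by (simp add: X_def)
    from this [of 1] this [of 2] this [of 3] X [of 1] X [of 2] X [of 3] calculation
    show ?thesis by linarith
  qed
  have "wsum K 6 (\<lambda>\<kappa>. norm (dft K f \<kappa>)) \<le> (\<Sum>\<kappa>\<in>freqs K. \<Sum>t\<in>?I. T t \<kappa>)"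
    unfolding wsum_def
  proof (rule sum_mono)
    fix \<kappa>
    have "freq_size \<kappa> powr 6 * (norm (dft K f \<kappa>))\<^sup>2 \<le> (1 + X 1 \<kappa> ^ 6 + X 2 \<kappa> ^ 6 + X 3 \<kappa> ^ 6) * (norm (dft K f \<kappa>))\<^sup>2"
      using le by (intro mult_right_mono) auto
    also have "\<dots> = (\<Sum>t\<in>?I. T t \<kappa>)"
      by (simp add: T_def power_mult_distrib distrib_right flip: power_mult)
    finally show "freq_size \<kappa> powr 6 * (norm (dft K f \<kappa>))\<^sup>2 \<le> (\<Sum>t\<in>?I. T t \<kappa>)" .
  qed
  also have "\<dots> = (\<Sum>t\<in>?I. \<Sum>\<kappa>\<in>freqs K. T t \<kappa>)" by (rule sum.swap)
  also have "\<dots> \<le> (\<Sum>t\<in>{(\<alpha>, \<beta>, \<gamma>). \<alpha> + \<beta> + \<gamma> \<le> 3}. \<Sum>\<kappa>\<in>freqs K. T t \<kappa>)"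
    by (intro sum_mono2 finite_multi_indices sum_nonneg) (auto simp: T_def)
  also have "\<dots> = (sobolev_norm 3 (spectral_interp K f))\<^sup>2"
    unfolding sobolev_norm_sq by (intro sum.cong) (auto simp: T_def X_def)
  finally show ?thesis .
qed

text \<open>
  Each of the at most \<open>4 ^ 3\<close> multi-indices of order at most 3 contributes a symbol of modulus at most \<open>(2 \<pi> freq_size) ^ 3\<close>.
\<close>

lemma sobolev_norm_le_wsum_6:
  "(sobolev_norm 3 (spectral_interp K f))\<^sup>2 \<le> 64 * (2 * pi) ^ 6 * wsum K 6 (\<lambda>\<kappa>. norm (dft K f \<kappa>))"
proof -
  define X where "X i \<kappa> = 2 * pi * \<bar>of_int (wave_comp i \<kappa>)\<bar>" for i \<kappa>
  let ?I = "{(\<alpha>, \<beta>, \<gamma>). \<alpha> + \<beta> + \<gamma> \<le> (3 :: nat)}"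
  let ?w = "wsum K 6 (\<lambda>\<kappa>. norm (dft K f \<kappa>))"
  have one: "(\<Sum>\<kappa>\<in>freqs K. (X 1 \<kappa> ^ \<alpha> * X 2 \<kappa> ^ \<beta> * X 3 \<kappa> ^ \<gamma> * norm (dft K f \<kappa>))\<^sup>2) \<le> (2 * pi) ^ 6 * ?w"
    if "\<alpha> + \<beta> + \<gamma> \<le> 3" for \<alpha> \<beta> \<gamma>
    unfolding wsum_def sum_distrib_left
  proof (rule sum_mono)
    fix \<kappa>
    let ?J = "2 * pi * freq_size \<kappa>"
    have X: "0 \<le> X i \<kappa>" "X i \<kappa> \<le> ?J" for i
      using wave_comp_le_freq_size by (auto simp: X_def)
    have J: "1 \<le> ?J"
      using mult_mono [of 1 "2 * pi" 1 "freq_size \<kappa>"] pi_ge_two freq_size_ge_1 [of \<kappa>] by simp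
    have "X 1 \<kappa> ^ \<alpha> * X 2 \<kappa> ^ \<beta> * X 3 \<kappa> ^ \<gamma> \<le> ?J ^ \<alpha> * ?J ^ \<beta> * ?J ^ \<gamma>"
      using X J by (intro mult_mono power_mono mult_nonneg_nonneg) auto
    also have "\<dots> \<le> ?J ^ 3"
      using J that by (simp only: power_add [symmetric]) (intro power_increasing)
    finally have "(X 1 \<kappa> ^ \<alpha> * X 2 \<kappa> ^ \<beta> * X 3 \<kappa> ^ \<gamma> * norm (dft K f \<kappa>))\<^sup>2 \<le> (?J ^ 3 * norm (dft K f \<kappa>))\<^sup>2"
      using X by (intro power_mono mult_right_mono) auto
    also have "\<dots> = (2 * pi) ^ 6 * (freq_size \<kappa> powr 6 * (norm (dft K f \<kappa>))\<^sup>2)"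
      by (simp add: power_mult_distrib flip: power_mult)
    finally show "(X 1 \<kappa> ^ \<alpha> * X 2 \<kappa> ^ \<beta> * X 3 \<kappa> ^ \<gamma> * norm (dft K f \<kappa>))\<^sup>2
        \<le> (2 * pi) ^ 6 * (freq_size \<kappa> powr 6 * (norm (dft K f \<kappa>))\<^sup>2)" .
  qed
  have "(sobolev_norm 3 (spectral_interp K f))\<^sup>2 \<le> (\<Sum>t\<in>?I. (2 * pi) ^ 6 * ?w)"
    unfolding sobolev_norm_sq by (rule sum_mono) (use one in \<open>auto simp: X_def\<close>)
  also have "\<dots> = card ?I * ((2 * pi) ^ 6 * ?w)" by simp
  also have "\<dots> \<le> 64 * ((2 * pi) ^ 6 * ?w)"
  proof (intro mult_right_mono)
    have "card ?I \<le> card ({..3 :: nat} \<times> {..3 :: nat} \<times> {..3 :: nat})"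
      by (intro card_mono) auto
    then show "real (card ?I) \<le> 64" by simp
  qed auto
  finally show ?thesis by simp
qed

section \<open>The nonlinear part of the energy\<close>

lemma card_nodes: "mesh K ^ 3 * real (card (nodes K)) = 1"
proof -
  have "real (card (nodes K)) = of_int (num_pts K) ^ 3"
    using num_pts_pos [of K] by (simp add: nodes_def power3_eq_cube)
  then show ?thesis
    using num_pts_pos [of K] by (simp add: mesh_def power_divide)
qed

lemma grid_norm_power:
  assumes "0 < q"
  shows "grid_norm K (real q) f ^ q = mesh K ^ 3 * (\<Sum>p\<in>nodes K. norm (f p) ^ q)"
proof -
  have "norm (f p) powr real q = norm (f p) ^ q" for p
    using assms by (cases "f p = 0") (auto simp: powr_realpow)
  moreover have "0 \<le> mesh K ^ 3 * (\<Sum>p\<in>nodes K. norm (f p) ^ q)"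
    using num_pts_pos [of K] by (auto simp: mesh_def intro!: mult_nonneg_nonneg sum_nonneg)
  moreover have "(x powr (1 / real q)) ^ q = x" if "0 \<le> x" for x :: real
    using that assms by (cases "x = 0") (auto simp: powr_power)
  ultimately show ?thesis by (simp add: grid_norm_def)
qed

text \<open>
  Completing the square uses that the cube has volume 1. It shows that the quantity under the square root in
  the scheme never falls below 1.
\<close>

lemma E1_N_eq:
  "E1_N K \<phi> = mesh K ^ 3 * (\<Sum>p\<in>nodes K. (norm (grad_N K \<phi> p) ^ 2 / 2 - 1) ^ 2 + 1)"
proof -
  have vol: "measure lborel unit_cube = 1" by (simp add: measure_def emeasure_unit_cube)
  have sq: "(x ^ 2 / 2 - 1) ^ 2 + 1 = 1 / 4 * x ^ 4 - x ^ 2 + 2" for x :: real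
    by (simp add: power2_eq_square power4_eq_xxxx algebra_simps)
  have "mesh K ^ 3 * (\<Sum>p\<in>nodes K. (norm (grad_N K \<phi> p) ^ 2 / 2 - 1) ^ 2 + 1) =
      1 / 4 * (mesh K ^ 3 * (\<Sum>p\<in>nodes K. norm (grad_N K \<phi> p) ^ 4))
      - mesh K ^ 3 * (\<Sum>p\<in>nodes K. norm (grad_N K \<phi> p) ^ 2) + 2 * (mesh K ^ 3 * real (card (nodes K)))"
    unfolding sq by (simp add: sum.distrib sum_subtractf sum_distrib_left algebra_simps)
  then show ?thesis
    using grid_norm_power [of 4 K "grad_N K \<phi>"] grid_norm_power [of 2 K "grad_N K \<phi>"]
    unfolding card_nodes by (simp add: E1_N_def vol)
qed

lemma mesh_cube_nonneg: "0 \<le> mesh K ^ 3"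
  using num_pts_pos [of K] by (simp add: mesh_def)

lemma E1_N_ge_1: "1 \<le> E1_N K \<phi>"
proof -
  have "1 = mesh K ^ 3 * (\<Sum>p\<in>nodes K. 1 :: real)" using card_nodes [of K] by simp
  also have "\<dots> \<le> E1_N K \<phi>"
    unfolding E1_N_eq by (intro mult_left_mono sum_mono mesh_cube_nonneg) auto
  finally show ?thesis .
qed

lemma E1_N_le:
  assumes "\<And>p. norm (grad_N K \<phi> p) \<le> V"
  shows "E1_N K \<phi> \<le> V ^ 4 + 2"
proof -
  have "E1_N K \<phi> \<le> mesh K ^ 3 * (\<Sum>p\<in>nodes K. V ^ 4 + 2)"
    unfolding E1_N_eq
  proof (intro mult_left_mono sum_mono mesh_cube_nonneg)
    fix p
    let ?x = "norm (grad_N K \<phi> p)"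
    have "(?x ^ 2 / 2 - 1) ^ 2 + 1 = 1 / 4 * ?x ^ 4 - ?x ^ 2 + 2"
      by (simp add: power2_eq_square power4_eq_xxxx algebra_simps)
    moreover have "?x ^ 4 \<le> V ^ 4" "0 \<le> ?x ^ 4" "0 \<le> ?x ^ 2" using power_mono [OF assms norm_ge_zero, of p] by auto
    ultimately show "(?x ^ 2 / 2 - 1) ^ 2 + 1 \<le> V ^ 4 + 2" by linarith
  qed
  also have "\<dots> = (mesh K ^ 3 * real (card (nodes K))) * (V ^ 4 + 2)" by simp
  finally show ?thesis by (simp only: card_nodes mult_1)
qed

text \<open>
  The discrete counterpart of the embedding of \<open>H^3\<close> into \<open>W^{1,\<infinity>}\<close>: the coefficients of the gradient are
  absolutely summable.
\<close>

lemma norm_grad_N_le: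
  "norm (grad_N K \<phi> p) \<le> 6 * pi * sqrt (lattice_const * wsum K 6 (\<lambda>\<kappa>. norm (dft K \<phi> \<kappa>)))"
proof -
  let ?u = "\<lambda>\<kappa>. norm (dft K \<phi> \<kappa>)"
  let ?s = "\<Sum>\<kappa>\<in>freqs K. freq_size \<kappa> * ?u \<kappa>"
  have comp: "\<bar>D_N K i \<phi> p\<bar> \<le> 2 * pi * ?s" for i
  proof -
    have "\<bar>D_N K i \<phi> p\<bar> \<le> (\<Sum>\<kappa>\<in>freqs K. norm (2 * of_real pi * \<i> * of_int (wave_comp i \<kappa>) * dft K \<phi> \<kappa> * wave \<kappa> (grid_point K p)))"
      unfolding D_N_def fourier_multiplier_def by (rule order_trans [OF abs_Re_le_cmod norm_sum])
    also have "\<dots> \<le> (\<Sum>\<kappa>\<in>freqs K. 2 * pi * (freq_size \<kappa> * ?u \<kappa>))"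
      using wave_comp_le_freq_size by (intro sum_mono) (auto simp: norm_mult intro!: mult_right_mono)
    finally show ?thesis by (simp add: sum_distrib_left)
  qed
  have "norm (grad_N K \<phi> p) \<le> (\<Sum>i\<in>UNIV. \<bar>grad_N K \<phi> p $ i\<bar>)" by (rule norm_le_l1_cart)
  also have "\<dots> \<le> (\<Sum>i\<in>(UNIV :: 3 set). 2 * pi * ?s)" unfolding grad_N_nth by (intro sum_mono comp)
  finally have "norm (grad_N K \<phi> p) \<le> 6 * pi * ?s" by simp
  also have "?s \<le> sqrt (lattice_const * wsum K 6 ?u)"
  proof (rule real_le_rsqrt)
    have "?s = (\<Sum>\<kappa>\<in>freqs K. freq_size \<kappa> powr (- 2) * (freq_size \<kappa> powr 3 * ?u \<kappa>))"
      by (intro sum.cong refl) (simp add: mult.assoc [symmetric] powr_add [symmetric] del: powr_numeral powr_neg_numeral)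
    then have "?s\<^sup>2 = (\<Sum>\<kappa>\<in>freqs K. freq_size \<kappa> powr (- 2) * (freq_size \<kappa> powr 3 * ?u \<kappa>))\<^sup>2"
      by (rule arg_cong)
    also have "\<dots> \<le> (\<Sum>\<kappa>\<in>freqs K. (freq_size \<kappa> powr (- 2))\<^sup>2) * (\<Sum>\<kappa>\<in>freqs K. (freq_size \<kappa> powr 3 * ?u \<kappa>)\<^sup>2)"
      by (rule Cauchy_Schwarz_ineq_sum)
    also have "(\<Sum>\<kappa>\<in>freqs K. (freq_size \<kappa> powr 3 * ?u \<kappa>)\<^sup>2) = wsum K 6 ?u"
      using wsum_weight [of K 0 3 ?u] by (simp add: wsum_0)
    also have "(\<Sum>\<kappa>\<in>freqs K. (freq_size \<kappa> powr (- 2))\<^sup>2) \<le> (\<Sum>\<kappa>\<in>freqs K. freq_size \<kappa> powr (- 7 / 2))"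
      using freq_size_ge_1 by (intro sum_mono) (auto simp: powr_power intro!: powr_mono simp del: powr_numeral powr_neg_numeral)
    also have "\<dots> \<le> lattice_const" by (rule lattice_const)
    finally show "?s\<^sup>2 \<le> lattice_const * wsum K 6 ?u" by (simp add: mult_right_mono)
  qed
  finally show ?thesis by simp
qed

section \<open>The scheme in Fourier space\<close>

lemma lam_nonneg [simp]: "0 \<le> lam \<kappa>"
  by (auto simp: lam_def intro!: mult_nonneg_nonneg sum_nonneg)

lemma lam_le: "lam \<kappa> \<le> 3 * (2 * pi)\<^sup>2 * (freq_size \<kappa>)\<^sup>2"
proof -
  have "(\<Sum>i\<in>UNIV. (of_int (wave_comp i \<kappa>))\<^sup>2) \<le> (\<Sum>i\<in>(UNIV :: 3 set). (freq_size \<kappa>)\<^sup>2)"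
    using wave_comp_le_freq_size by (intro sum_mono) (metis abs_le_square_iff abs_of_nonneg freq_size_pos(2))
  then show ?thesis by (simp add: lam_def)
qed

lemma freq_size_eq_or_lam_ge: "(lam \<kappa> = 0 \<and> freq_size \<kappa> = 1) \<or> (2 * pi)\<^sup>2 * (freq_size \<kappa>)\<^sup>2 \<le> lam \<kappa>"
proof (cases "\<kappa> = 0")
  case True
  then show ?thesis by (simp add: lam_def sum_3 freq_size_def wave_comp_def zero_prod_def)
next
  case False
  obtain l m n where k: "\<kappa> = (l, m, n)" by (cases \<kappa>)
  have "l \<noteq> 0 \<or> m \<noteq> 0 \<or> n \<noteq> 0" using False by (auto simp: k zero_prod_def)
  then have "1 \<le> \<bar>l\<bar> \<or> 1 \<le> \<bar>m\<bar> \<or> 1 \<le> \<bar>n\<bar>" by linarith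
  then have "1 \<le> \<bar>real_of_int l\<bar> \<or> 1 \<le> \<bar>real_of_int m\<bar> \<or> 1 \<le> \<bar>real_of_int n\<bar>" by linarith
  then have "freq_size \<kappa> = \<bar>of_int l\<bar> \<or> freq_size \<kappa> = \<bar>of_int m\<bar> \<or> freq_size \<kappa> = \<bar>of_int n\<bar>"
    by (auto simp: k freq_size_def max_def)
  then have "(freq_size \<kappa>)\<^sup>2 \<le> (of_int l)\<^sup>2 + (of_int m)\<^sup>2 + (of_int n)\<^sup>2"
    by auto
  then have "(2 * pi)\<^sup>2 * (freq_size \<kappa>)\<^sup>2 \<le> lam \<kappa>"
    unfolding lam_def sum_3 by (intro mult_left_mono) (auto simp: k wave_comp_def)
  then show ?thesis ..
qed

lemma grid_space_add: "f \<in> grid_space K \<Longrightarrow> g \<in> grid_space K \<Longrightarrow> (\<lambda>p. f p + g p) \<in> grid_space K"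
  by (simp add: grid_space_def)

lemma laplace_N_in_grid_space: "laplace_N K f \<in> grid_space K"
proof -
  have "laplace_N K f = (\<lambda>p. D_N K 1 (\<lambda>q. grad_N K f q $ 1) p + D_N K 2 (\<lambda>q. grad_N K f q $ 2) p
      + D_N K 3 (\<lambda>q. grad_N K f q $ 3) p)"
    by (simp add: laplace_N_def div_N_def D_N_simps fun_eq_iff)
  then show ?thesis by (simp add: grid_space_add D_N_in_grid_space)
qed

definition sav_factor :: "nat \<Rightarrow> (int \<Rightarrow> index \<Rightarrow> real) \<Rightarrow> (int \<Rightarrow> real) \<Rightarrow> int \<Rightarrow> real" where
  "sav_factor K \<phi> r n = r (n + 1) / sqrt (E1_N K (extrapolation \<phi> n))"

lemma dft_bdf2:
  "dft K (\<lambda>p. bdf2 dt (\<lambda>j. \<phi> j p) n) \<kappa> =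
     (3 / 2 * dft K (\<phi> (n + 1)) \<kappa> - 2 * dft K (\<phi> n) \<kappa> + 1 / 2 * dft K (\<phi> (n - 1)) \<kappa>) / of_real dt"
proof -
  have "(\<lambda>p. bdf2 dt (\<lambda>j. \<phi> j p) n) =
      (\<lambda>p. (3 / 2 / dt) * \<phi> (n + 1) p + ((- 2 / dt) * \<phi> n p + (1 / 2 / dt) * \<phi> (n - 1) p))"
    by (simp add: bdf2_def fun_eq_iff add_divide_distrib diff_divide_distrib)
  then show ?thesis
    by (simp only: dft_add dft_scale) (simp add: add_divide_distrib diff_divide_distrib)
qed

lemma dft_extrapolation:
  "dft K (extrapolation \<phi> n) \<kappa> = 2 * dft K (\<phi> n) \<kappa> - dft K (\<phi> (n - 1)) \<kappa>"
proof -
  have "extrapolation \<phi> n = (\<lambda>p. 2 * \<phi> n p + (- 1) * \<phi> (n - 1) p)"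
    by (simp add: extrapolation_def fun_eq_iff)
  then show ?thesis by (simp only: dft_add dft_scale) simp
qed

lemma sav_step_dft:
  assumes "sav_step K a dt \<phi> r n" "\<kappa> \<in> freqs K"
  shows "dft K (\<lambda>p. bdf2 dt (\<lambda>j. \<phi> j p) n) \<kappa> =
     - of_real (lam \<kappa>) * (of_real (sav_factor K \<phi> r n) * dft K (N_N K (extrapolation \<phi> n)) \<kappa>
        + of_real (a + (lam \<kappa>)\<^sup>2) * dft K (\<phi> (n + 1)) \<kappa>)"
proof -
  let ?N = "N_N K (extrapolation \<phi> n)" and ?s = "sav_factor K \<phi> r n"
  let ?G = "\<lambda>q. ?s * ?N q + (a * \<phi> (n + 1) q + laplace_N K (laplace_N K (\<phi> (n + 1))) q)"
  have "(\<lambda>p. bdf2 dt (\<lambda>j. \<phi> j p) n) = laplace_N K ?G"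
    using assms(1) by (simp add: sav_step_def fun_eq_iff sav_factor_def L_N_def)
  moreover have "dft K ?G \<kappa> = of_real ?s * dft K ?N \<kappa> + of_real (a + (lam \<kappa>)\<^sup>2) * dft K (\<phi> (n + 1)) \<kappa>"
    by (simp only: dft_add dft_scale dft_laplace_N [OF assms(2)])
      (simp add: power2_eq_square algebra_simps)
  ultimately show ?thesis by (simp only: dft_laplace_N [OF assms(2)])
qed

text \<open>
  The nonlinear term is rescaled by the linear symbol \<open>a + lam\<^sup>2\<close>, so that the step size and the wave vector enter
  the linear part of the recursion only through \<open>z\<close>, and the rescaled forcing does not contain the step size.
\<close>

lemma sav_mode_recursion:
  assumes "sav_step K a dt \<phi> r n" "\<kappa> \<in> freqs K" "0 < dt" "0 < a"
  defines "z \<equiv> dt * lam \<kappa> * (a + (lam \<kappa>)\<^sup>2)"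
    and "f \<equiv> - of_real (sav_factor K \<phi> r n) * dft K (N_N K (extrapolation \<phi> n)) \<kappa> / of_real (a + (lam \<kappa>)\<^sup>2)"
  shows "(3 / 2 + of_real z) * dft K (\<phi> (n + 1)) \<kappa> =
    2 * dft K (\<phi> n) \<kappa> - 1 / 2 * dft K (\<phi> (n - 1)) \<kappa> + of_real z * f"
proof -
  let ?b = "complex_of_real (a + (lam \<kappa>)\<^sup>2)"
  have b: "?b \<noteq> 0" using assms(4) by (simp only: of_real_eq_0_iff) (smt (verit) zero_le_power2)
  have zf: "of_real z * f = - of_real dt * of_real (lam \<kappa>) * (of_real (sav_factor K \<phi> r n) * dft K (N_N K (extrapolation \<phi> n)) \<kappa>)"
    using b by (simp add: z_def f_def)
  have "3 / 2 * dft K (\<phi> (n + 1)) \<kappa> - 2 * dft K (\<phi> n) \<kappa> + 1 / 2 * dft K (\<phi> (n - 1)) \<kappa> =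
      of_real dt * (- of_real (lam \<kappa>) * (of_real (sav_factor K \<phi> r n) * dft K (N_N K (extrapolation \<phi> n)) \<kappa>
        + ?b * dft K (\<phi> (n + 1)) \<kappa>))"
    using sav_step_dft [OF assms(1,2)] assms(3) by (simp add: dft_bdf2 field_simps)
  also have "\<dots> = of_real z * f - of_real z * dft K (\<phi> (n + 1)) \<kappa>"
    unfolding zf by (simp add: z_def algebra_simps)
  finally show ?thesis by (simp add: algebra_simps)
qed

section \<open>Dissipation of the modified energy\<close>

definition sav_energy :: "nat \<Rightarrow> real \<Rightarrow> (int \<Rightarrow> index \<Rightarrow> real) \<Rightarrow> (int \<Rightarrow> real) \<Rightarrow> int \<Rightarrow> real" where
  "sav_energy K a \<phi> r n = 2 * ((r n)\<^sup>2 + (2 * r n - r (n - 1))\<^sup>2) +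
     (\<Sum>\<kappa>\<in>freqs K. (a + (lam \<kappa>)\<^sup>2) * ((norm (dft K (\<phi> n) \<kappa>))\<^sup>2 +
        (norm (2 * dft K (\<phi> n) \<kappa> - dft K (\<phi> (n - 1)) \<kappa>))\<^sup>2))"

text \<open>
  The equation for the phase field is tested with its chemical potential and the equation for the auxiliary
  variable with that variable itself. The two nonlinear contributions cancel, and what remains has a sign.
\<close>

lemma sav_energy_decreasing:
  assumes step: "sav_step K a dt \<phi> r n" and "0 < dt" "0 < a"
  shows "sav_energy K a \<phi> r (n + 1) \<le> sav_energy K a \<phi> r n"
proof -
  let ?u = "\<lambda>j \<kappa>. dft K (\<phi> j) \<kappa>"
  let ?N = "N_N K (extrapolation \<phi> n)" and ?s = "sav_factor K \<phi> r n"
  define \<delta> where "\<delta> = (\<lambda>p. bdf2 dt (\<lambda>j. \<phi> j p) n)"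
  define b where "b \<kappa> = a + (lam \<kappa>)\<^sup>2" for \<kappa>
  have b: "0 \<le> b \<kappa>" for \<kappa> using assms(3) by (simp add: b_def)
  have \<delta>_grid: "\<delta> \<in> grid_space K"
  proof -
    have "\<delta> = laplace_N K (\<lambda>q. ?s * ?N q + L_N K a (\<phi> (n + 1)) q)"
      using step by (simp add: \<delta>_def sav_step_def fun_eq_iff sav_factor_def)
    then show ?thesis using laplace_N_in_grid_space by metis
  qed
  have "2 * r (n + 1) * bdf2 dt r n = ?s * grid_inner K \<delta> ?N"
    using step E1_N_ge_1 [of K "extrapolation \<phi> n"]
    by (simp add: sav_step_def \<delta>_def sav_factor_def grid_inner_def mult.commute)
  also have "grid_inner K \<delta> ?N = Re (\<Sum>\<kappa>\<in>freqs K. dft K \<delta> \<kappa> * cnj (dft K ?N \<kappa>))"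
    using parseval [OF \<delta>_grid, of ?N] by (metis Re_complex_of_real)
  also have "?s * \<dots> = (\<Sum>\<kappa>\<in>freqs K. Re (dft K \<delta> \<kappa> * cnj (of_real ?s * dft K ?N \<kappa>)))"
    by (simp add: sum_distrib_left algebra_simps)
  also have "\<dots> \<le> (\<Sum>\<kappa>\<in>freqs K. - b \<kappa> * Re (cnj (?u (n + 1) \<kappa>) * dft K \<delta> \<kappa>))"
  proof (rule sum_mono)
    fix \<kappa> assume k: "\<kappa> \<in> freqs K"
    define w where "w = of_real ?s * dft K ?N \<kappa> + of_real (b \<kappa>) * ?u (n + 1) \<kappa>"
    have d: "dft K \<delta> \<kappa> = - of_real (lam \<kappa>) * w"
      using sav_step_dft [OF step k] by (simp only: \<delta>_def w_def b_def)
    have "Re (dft K \<delta> \<kappa> * cnj w) = - (lam \<kappa> * (norm w)\<^sup>2)"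
      by (simp only: d cmod_power2) (simp add: power2_eq_square algebra_simps)
    also have "\<dots> \<le> 0" by simp
    finally have "Re (dft K \<delta> \<kappa> * cnj w) \<le> 0" .
    then show "Re (dft K \<delta> \<kappa> * cnj (of_real ?s * dft K ?N \<kappa>)) \<le> - b \<kappa> * Re (cnj (?u (n + 1) \<kappa>) * dft K \<delta> \<kappa>)"
      by (simp add: w_def algebra_simps)
  qed
  also have "\<dots> = - (\<Sum>\<kappa>\<in>freqs K. b \<kappa> * Re (cnj (?u (n + 1) \<kappa>) * dft K \<delta> \<kappa>))"
    by (simp add: sum_negf)
  finally have "4 * dt * (2 * r (n + 1) * bdf2 dt r n) \<le>
      4 * dt * - (\<Sum>\<kappa>\<in>freqs K. b \<kappa> * Re (cnj (?u (n + 1) \<kappa>) * dft K \<delta> \<kappa>))"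
    using assms(2) by (intro mult_left_mono) auto
  then have main: "4 * dt * (2 * r (n + 1) * bdf2 dt r n) +
      4 * dt * (\<Sum>\<kappa>\<in>freqs K. b \<kappa> * Re (cnj (?u (n + 1) \<kappa>) * dft K \<delta> \<kappa>)) \<le> 0"
    unfolding mult_minus_right by linarith
  have r: "4 * dt * (2 * r (n + 1) * bdf2 dt r n) \<ge>
      2 * ((r (n + 1))\<^sup>2 + (2 * r (n + 1) - r n)\<^sup>2) - 2 * ((r n)\<^sup>2 + (2 * r n - r (n - 1))\<^sup>2)"
  proof -
    have "4 * dt * (2 * r (n + 1) * bdf2 dt r n) = 8 * r (n + 1) * (3 / 2 * r (n + 1) - 2 * r n + 1 / 2 * r (n - 1))"
      using assms(2) by (simp add: bdf2_def)
    also have "\<dots> = 2 * ((r (n + 1))\<^sup>2 + (2 * r (n + 1) - r n)\<^sup>2) - 2 * ((r n)\<^sup>2 + (2 * r n - r (n - 1))\<^sup>2)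
        + 2 * (r (n + 1) - 2 * r n + r (n - 1))\<^sup>2"
      by (simp add: power2_eq_square algebra_simps)
    finally show ?thesis by simp
  qed
  define e where "e j \<kappa> = (norm (?u j \<kappa>))\<^sup>2 + (norm (2 * ?u j \<kappa> - ?u (j - 1) \<kappa>))\<^sup>2" for j \<kappa>
  have u: "(\<Sum>\<kappa>\<in>freqs K. b \<kappa> * e (n + 1) \<kappa>) - (\<Sum>\<kappa>\<in>freqs K. b \<kappa> * e n \<kappa>) \<le>
      4 * dt * (\<Sum>\<kappa>\<in>freqs K. b \<kappa> * Re (cnj (?u (n + 1) \<kappa>) * dft K \<delta> \<kappa>))"
    unfolding sum_distrib_left sum_subtractf [symmetric]
  proof (rule sum_mono)
    fix \<kappa>
    let ?x = "?u (n + 1) \<kappa>" and ?y = "?u n \<kappa>" and ?w = "?u (n - 1) \<kappa>"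
    have "of_real dt * dft K \<delta> \<kappa> = 3 / 2 * ?x - 2 * ?y + 1 / 2 * ?w"
      using assms(2) by (simp add: \<delta>_def dft_bdf2)
    then have "4 * Re (cnj ?x * (of_real dt * dft K \<delta> \<kappa>)) \<ge> e (n + 1) \<kappa> - e n \<kappa>"
      using bdf2_identity [of ?x ?y ?w] zero_le_power2 [of "norm (?x - 2 * ?y + ?w)"]
      by (simp only: e_def add_diff_cancel_right')
    also have "4 * Re (cnj ?x * (of_real dt * dft K \<delta> \<kappa>)) = 4 * dt * Re (cnj ?x * dft K \<delta> \<kappa>)"
      by (simp add: algebra_simps)
    finally have "b \<kappa> * (e (n + 1) \<kappa> - e n \<kappa>) \<le> b \<kappa> * (4 * dt * Re (cnj ?x * dft K \<delta> \<kappa>))"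
      using b by (intro mult_left_mono) auto
    then show "b \<kappa> * e (n + 1) \<kappa> - b \<kappa> * e n \<kappa> \<le> 4 * dt * (b \<kappa> * Re (cnj ?x * dft K \<delta> \<kappa>))"
      by (simp add: algebra_simps)
  qed
  have "sav_energy K a \<phi> r j = 2 * ((r j)\<^sup>2 + (2 * r j - r (j - 1))\<^sup>2) + (\<Sum>\<kappa>\<in>freqs K. b \<kappa> * e j \<kappa>)" for j
    by (simp add: sav_energy_def b_def e_def)
  from this [of n] this [of "n + 1"] show ?thesis using main r u unfolding add_diff_cancel_right' by linarith
qed

section \<open>The uniform second-order bound\<close>

text \<open>
  The hypotheses on a numerical solution, gathered so that uniformity of a bound means independence of everything
  but \<open>a\<close>, \<open>M0\<close> and \<open>M1\<close>.
\<close>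

definition admissible ::
    "real \<Rightarrow> real \<Rightarrow> real \<Rightarrow> nat \<Rightarrow> real \<Rightarrow> (int \<Rightarrow> index \<Rightarrow> real) \<Rightarrow> (int \<Rightarrow> real) \<Rightarrow> bool" where
  "admissible a M0 M1 K dt \<phi> r \<longleftrightarrow> 0 < dt \<and> sav_solution K a dt \<phi> r \<and>
     sobolev_norm 3 (spectral_interp K (\<phi> 0)) \<le> M0 \<and> sobolev_norm 3 (spectral_interp K (\<phi> (- 1))) \<le> M1"

abbreviation amp :: "nat \<Rightarrow> (index \<Rightarrow> real) \<Rightarrow> index \<Rightarrow> real" where
  "amp K f \<equiv> \<lambda>\<kappa>. norm (dft K f \<kappa>)"

lemma sobolev_norm_nonneg: "0 \<le> sobolev_norm s u"
  unfolding sobolev_norm_def set_lebesgue_integral_def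
  by (auto intro!: real_sqrt_ge_zero sum_nonneg Bochner_Integration.integral_nonneg)

lemma admissible_initial:
  assumes "admissible a M0 M1 K dt \<phi> r"
  shows "wsum K 6 (amp K (\<phi> 0)) \<le> M0\<^sup>2" "wsum K 6 (amp K (\<phi> (- 1))) \<le> M1\<^sup>2"
  using assms wsum_6_le_sobolev_norm [of K "\<phi> 0"] wsum_6_le_sobolev_norm [of K "\<phi> (- 1)"]
    power_mono [OF _ sobolev_norm_nonneg, of 3 "spectral_interp K (\<phi> 0)" M0 2]
    power_mono [OF _ sobolev_norm_nonneg, of 3 "spectral_interp K (\<phi> (- 1))" M1 2]
  unfolding admissible_def by linarith+

lemma admissible_step: "admissible a M0 M1 K dt \<phi> r \<Longrightarrow> 0 \<le> n \<Longrightarrow> sav_step K a dt \<phi> r n"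
  by (simp add: admissible_def sav_solution_def)

lemma admissible_energy_le:
  assumes adm: "admissible a M0 M1 K dt \<phi> r" and a: "0 < a"
  shows "sav_energy K a \<phi> r (int n) \<le> sav_energy K a \<phi> r 0"
proof (induction n)
  case (Suc n)
  have "sav_energy K a \<phi> r (int n + 1) \<le> sav_energy K a \<phi> r (int n)"
    using adm a by (intro sav_energy_decreasing [where dt = dt] admissible_step [OF adm]) (auto simp: admissible_def)
  with Suc show ?case by (simp add: add.commute)
qed simp

text \<open>
  The energy dominates second derivatives and the auxiliary variable at all later times, and its initial value is
  controlled by third derivatives: the quartic part needs the maximum norm of the gradient.
\<close>

lemma uniform_H2_bound:
  assumes a: "0 < a" "a \<le> 1"
  shows "\<exists>B\<ge>0. \<forall>K dt \<phi> r n. admissible a M0 M1 K dt \<phi> r \<longrightarrow> - 1 \<le> n \<longrightarrow>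
     wsum K 4 (amp K (\<phi> n)) \<le> B \<and> (0 \<le> n \<longrightarrow> \<bar>r n\<bar> \<le> B)"
proof -
  define V where "V M = (6 * pi * sqrt (lattice_const * M\<^sup>2)) ^ 4 + 2" for M
  define C where "C = 1 + 9 * (2 * pi) ^ 4"
  define G where "G = 18 * V M0 + 4 * V M1 + C * (9 * M0\<^sup>2 + 2 * M1\<^sup>2)"
  define B where "B = G / a + G + 1 + M1\<^sup>2"
  have V: "0 \<le> V M" for M by (simp add: V_def)
  have C: "0 \<le> C" by (simp add: C_def)
  have G: "0 \<le> G" using V C by (simp add: G_def)
  have B: "0 \<le> B" using a G by (simp add: B_def)
  have "wsum K 4 (amp K (\<phi> n)) \<le> B \<and> (0 \<le> n \<longrightarrow> \<bar>r n\<bar> \<le> B)"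
    if adm: "admissible a M0 M1 K dt \<phi> r" and n: "- 1 \<le> n" for K dt \<phi> r n
  proof -
    let ?u = "\<lambda>j \<kappa>. dft K (\<phi> j) \<kappa>"
    have E1: "E1_N K f \<le> V M" if "wsum K 6 (amp K f) \<le> M\<^sup>2" for f M
      unfolding V_def
      using that lattice_const(1)
      by (intro E1_N_le order_trans [OF norm_grad_N_le] mult_left_mono) (auto intro: mult_left_mono)
    have r0: "(r 0)\<^sup>2 \<le> V M0" and r1: "(r (- 1))\<^sup>2 \<le> V M1"
      using adm E1 [OF admissible_initial(1) [OF adm]] E1 [OF admissible_initial(2) [OF adm]]
        E1_N_ge_1 [of K "\<phi> 0"] E1_N_ge_1 [of K "\<phi> (- 1)"]
      by (auto simp: admissible_def sav_solution_def)
    have "sav_energy K a \<phi> r 0 \<le> G"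
    proof -
      have sq: "(2 * x - y)\<^sup>2 \<le> 8 * x\<^sup>2 + 2 * y\<^sup>2" for x y :: real
        using zero_le_power2 [of "2 * x + y"] by (simp add: power2_eq_square algebra_simps)
      have "2 * ((r 0)\<^sup>2 + (2 * r 0 - r (- 1))\<^sup>2) \<le> 2 * ((r 0)\<^sup>2 + (8 * (r 0)\<^sup>2 + 2 * (r (- 1))\<^sup>2))"
        by (intro mult_left_mono add_left_mono sq) auto
      also have "\<dots> \<le> 18 * V M0 + 4 * V M1" using r0 r1 by simp
      finally have r: "2 * ((r 0)\<^sup>2 + (2 * r 0 - r (- 1))\<^sup>2) \<le> 18 * V M0 + 4 * V M1" .
      have "(\<Sum>\<kappa>\<in>freqs K. (a + (lam \<kappa>)\<^sup>2) * ((norm (?u 0 \<kappa>))\<^sup>2 + (norm (2 * ?u 0 \<kappa> - ?u (- 1) \<kappa>))\<^sup>2))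
          \<le> (\<Sum>\<kappa>\<in>freqs K. C * (9 * (freq_size \<kappa> powr 6 * (norm (?u 0 \<kappa>))\<^sup>2) + 2 * (freq_size \<kappa> powr 6 * (norm (?u (- 1) \<kappa>))\<^sup>2)))"
      proof (rule sum_mono)
        fix \<kappa>
        let ?J = "freq_size \<kappa>"
        have J: "1 \<le> ?J ^ 6" "?J ^ 4 \<le> ?J ^ 6"
          using freq_size_ge_1 [of \<kappa>] by (auto intro: power_increasing)
        have "(lam \<kappa>)\<^sup>2 \<le> (3 * (2 * pi)\<^sup>2 * ?J\<^sup>2)\<^sup>2"
          by (intro power_mono lam_le lam_nonneg)
        also have "\<dots> = 9 * (2 * pi) ^ 4 * ?J ^ 4"
          by (simp add: power_mult_distrib flip: power_mult)
        also have "\<dots> \<le> 9 * (2 * pi) ^ 4 * ?J ^ 6" using J by (intro mult_left_mono) auto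
        finally have wt: "a + (lam \<kappa>)\<^sup>2 \<le> C * ?J powr 6"
          using a J by (simp add: C_def algebra_simps)
        have "(norm (2 * ?u 0 \<kappa> - ?u (- 1) \<kappa>))\<^sup>2 + (norm (2 * ?u 0 \<kappa> + ?u (- 1) \<kappa>))\<^sup>2 =
            8 * (norm (?u 0 \<kappa>))\<^sup>2 + 2 * (norm (?u (- 1) \<kappa>))\<^sup>2"
          unfolding cmod_power2 by (simp add: power2_eq_square algebra_simps)
        then have "(norm (?u 0 \<kappa>))\<^sup>2 + (norm (2 * ?u 0 \<kappa> - ?u (- 1) \<kappa>))\<^sup>2 \<le>
            9 * (norm (?u 0 \<kappa>))\<^sup>2 + 2 * (norm (?u (- 1) \<kappa>))\<^sup>2"
          using zero_le_power2 [of "norm (2 * ?u 0 \<kappa> + ?u (- 1) \<kappa>)"] by linarith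
        then have "(a + (lam \<kappa>)\<^sup>2) * ((norm (?u 0 \<kappa>))\<^sup>2 + (norm (2 * ?u 0 \<kappa> - ?u (- 1) \<kappa>))\<^sup>2) \<le>
            C * ?J powr 6 * (9 * (norm (?u 0 \<kappa>))\<^sup>2 + 2 * (norm (?u (- 1) \<kappa>))\<^sup>2)"
          using wt C by (intro mult_mono) auto
        then show "(a + (lam \<kappa>)\<^sup>2) * ((norm (?u 0 \<kappa>))\<^sup>2 + (norm (2 * ?u 0 \<kappa> - ?u (- 1) \<kappa>))\<^sup>2) \<le>
            C * (9 * (?J powr 6 * (norm (?u 0 \<kappa>))\<^sup>2) + 2 * (?J powr 6 * (norm (?u (- 1) \<kappa>))\<^sup>2))"
          by (simp add: algebra_simps)
      qed
      also have "\<dots> = C * (9 * wsum K 6 (amp K (\<phi> 0)) + 2 * wsum K 6 (amp K (\<phi> (- 1))))"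
        unfolding wsum_def sum_distrib_left [symmetric] sum.distrib ..
      also have "\<dots> \<le> C * (9 * M0\<^sup>2 + 2 * M1\<^sup>2)"
        using admissible_initial [OF adm] C by (intro mult_left_mono add_mono) auto
      finally show ?thesis using r by (simp add: sav_energy_def G_def)
    qed
    show ?thesis
    proof (cases "n = - 1")
      case True
      have "wsum K 4 (amp K (\<phi> (- 1))) \<le> wsum K 6 (amp K (\<phi> (- 1)))" by (rule wsum_mono) auto
      moreover have "0 \<le> G / a" using a G by simp
      ultimately have "wsum K 4 (amp K (\<phi> (- 1))) \<le> B"
        using admissible_initial(2) [OF adm] G unfolding B_def by linarith
      with True show ?thesis by simp
    next
      case False
      define S where "S = (\<Sum>\<kappa>\<in>freqs K. (a + (lam \<kappa>)\<^sup>2) * (norm (?u n \<kappa>))\<^sup>2)"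
      have S0: "0 \<le> S" unfolding S_def using a by (intro sum_nonneg mult_nonneg_nonneg) auto
      have "sav_energy K a \<phi> r n \<le> sav_energy K a \<phi> r 0"
        using admissible_energy_le [OF adm a(1), of "nat n"] False n by simp
      moreover have "2 * (r n)\<^sup>2 + S \<le> sav_energy K a \<phi> r n"
      proof -
        have "S \<le> (\<Sum>\<kappa>\<in>freqs K. (a + (lam \<kappa>)\<^sup>2) * ((norm (?u n \<kappa>))\<^sup>2 + (norm (2 * ?u n \<kappa> - ?u (n - 1) \<kappa>))\<^sup>2))"
          unfolding S_def using a by (intro sum_mono mult_left_mono) auto
        then show ?thesis unfolding sav_energy_def by (intro add_mono) auto
      qed
      ultimately have GS: "2 * (r n)\<^sup>2 + S \<le> G" using \<open>sav_energy K a \<phi> r 0 \<le> G\<close> by linarith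
      have "a * wsum K 4 (amp K (\<phi> n)) \<le> S"
        unfolding wsum_def S_def sum_distrib_left
      proof (rule sum_mono)
        fix \<kappa>
        let ?J = "freq_size \<kappa>"
        have "a * ?J ^ 4 \<le> a + (lam \<kappa>)\<^sup>2"
          using freq_size_eq_or_lam_ge [of \<kappa>]
        proof
          assume "(2 * pi)\<^sup>2 * ?J\<^sup>2 \<le> lam \<kappa>"
          moreover have "1 * ?J\<^sup>2 \<le> (2 * pi)\<^sup>2 * ?J\<^sup>2"
            using pi_ge_two by (intro mult_right_mono one_le_power) auto
          ultimately have "?J\<^sup>2 \<le> lam \<kappa>" by linarith
          then have "(?J\<^sup>2)\<^sup>2 \<le> (lam \<kappa>)\<^sup>2" by (intro power_mono) auto
          moreover have "a * ?J ^ 4 \<le> 1 * ?J ^ 4" using a by (intro mult_right_mono) auto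
          moreover have "(?J\<^sup>2)\<^sup>2 = ?J ^ 4" by (simp flip: power_mult)
          ultimately show ?thesis using a by linarith
        qed (use a in auto)
        then have "a * ?J ^ 4 * (norm (?u n \<kappa>))\<^sup>2 \<le> (a + (lam \<kappa>)\<^sup>2) * (norm (?u n \<kappa>))\<^sup>2"
          by (intro mult_right_mono) auto
        then show "a * (?J powr 4 * (norm (?u n \<kappa>))\<^sup>2) \<le> (a + (lam \<kappa>)\<^sup>2) * (norm (?u n \<kappa>))\<^sup>2" by simp
      qed
      also have "S \<le> G" using GS zero_le_power2 [of "r n"] by linarith
      finally have "wsum K 4 (amp K (\<phi> n)) \<le> G / a" using a by (simp add: field_simps)
      moreover have "\<bar>r n\<bar> \<le> 1 + (r n)\<^sup>2"
        using zero_le_power2 [of "\<bar>r n\<bar> - 1"] by (simp add: power2_eq_square algebra_simps)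
      moreover have "(r n)\<^sup>2 \<le> G" using GS S0 zero_le_power2 [of "r n"] by linarith
      moreover have "0 \<le> G / a" using a G by simp
      ultimately show ?thesis using G zero_le_power2 [of M1] unfolding B_def by linarith
    qed
  qed
  with B show ?thesis by blast
qed

section \<open>The nonlinear forcing in Fourier space\<close>

text \<open>
  Pointwise in frequency, moduli of coefficients of products are bounded by cyclic convolutions of moduli.
\<close>

lemma norm_dft_cubic_le:
  assumes "\<kappa> \<in> freqs K"
  shows "norm (dft K (\<lambda>q. (norm (grad_N K \<psi> q))\<^sup>2 * D_N K i \<psi> q) \<kappa>) \<le>
     3 * (2 * pi) ^ 3 * cconv_cube K (\<lambda>\<eta>. freq_size \<eta> * amp K \<psi> \<eta>) \<kappa>"
proof -
  let ?Q = "\<lambda>\<eta>. 2 * pi * (freq_size \<eta> * amp K \<psi> \<eta>)"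
  have D: "amp K (D_N K j \<psi>) \<eta> \<le> ?Q \<eta>" if "\<eta> \<in> freqs K" for j \<eta>
    using wave_comp_le_freq_size by (simp add: dft_D_N [OF that] norm_mult mult_right_mono)
  have conv: "amp K (\<lambda>p. f p * g p) \<eta> \<le> cconv K (amp K f) (amp K g) \<eta>"
    if "f \<in> grid_space K" for f g \<eta>
    unfolding dft_mult [OF that] cconv_def by (rule order_trans [OF norm_sum]) (simp add: norm_mult)
  have "amp K (\<lambda>q. D_N K j \<psi> q * (D_N K j \<psi> q * D_N K i \<psi> q)) \<kappa> \<le> cconv_cube K ?Q \<kappa>" for j
  proof -
    have "amp K (\<lambda>q. D_N K j \<psi> q * (D_N K j \<psi> q * D_N K i \<psi> q)) \<kappa> \<le>
        cconv K (amp K (D_N K j \<psi>)) (amp K (\<lambda>q. D_N K j \<psi> q * D_N K i \<psi> q)) \<kappa>"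
      by (rule conv [OF D_N_in_grid_space])
    also have "\<dots> \<le> cconv K ?Q (cconv K ?Q ?Q) \<kappa>"
    proof (rule cconv_mono)
      fix \<eta> assume "\<eta> \<in> freqs K"
      have "amp K (\<lambda>q. D_N K j \<psi> q * D_N K i \<psi> q) \<eta> \<le> cconv K (amp K (D_N K j \<psi>)) (amp K (D_N K i \<psi>)) \<eta>"
        by (rule conv [OF D_N_in_grid_space])
      also have "\<dots> \<le> cconv K ?Q ?Q \<eta>" by (rule cconv_mono) (use D in auto)
      finally show "amp K (\<lambda>q. D_N K j \<psi> q * D_N K i \<psi> q) \<eta> \<le> cconv K ?Q ?Q \<eta>" .
    qed (use D in auto)
    finally show ?thesis by (simp add: cconv_cube_def)
  qed
  note bound = this
  have "(norm (grad_N K \<psi> q))\<^sup>2 = (\<Sum>j\<in>UNIV. (D_N K j \<psi> q)\<^sup>2)" for q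
    unfolding power2_norm_eq_inner inner_vec_def by (simp add: grad_N_nth power2_eq_square)
  then have "(\<lambda>q. (norm (grad_N K \<psi> q))\<^sup>2 * D_N K i \<psi> q) =
      (\<lambda>q. D_N K 1 \<psi> q * (D_N K 1 \<psi> q * D_N K i \<psi> q) +
        (D_N K 2 \<psi> q * (D_N K 2 \<psi> q * D_N K i \<psi> q) + D_N K 3 \<psi> q * (D_N K 3 \<psi> q * D_N K i \<psi> q)))"
    by (simp add: sum_3 fun_eq_iff power2_eq_square algebra_simps)
  then have "norm (dft K (\<lambda>q. (norm (grad_N K \<psi> q))\<^sup>2 * D_N K i \<psi> q) \<kappa>) \<le>
      amp K (\<lambda>q. D_N K 1 \<psi> q * (D_N K 1 \<psi> q * D_N K i \<psi> q)) \<kappa> +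
      (amp K (\<lambda>q. D_N K 2 \<psi> q * (D_N K 2 \<psi> q * D_N K i \<psi> q)) \<kappa> +
       amp K (\<lambda>q. D_N K 3 \<psi> q * (D_N K 3 \<psi> q * D_N K i \<psi> q)) \<kappa>)"
    by (simp only: dft_add) (intro norm_triangle_le add_left_mono norm_triangle_ineq)
  also have "\<dots> \<le> 3 * cconv_cube K ?Q \<kappa>"
    using bound [of 1] bound [of 2] bound [of 3] by linarith
  also have "cconv_cube K ?Q \<kappa> = (2 * pi) ^ 3 * cconv_cube K (\<lambda>\<eta>. freq_size \<eta> * amp K \<psi> \<eta>) \<kappa>"
    by (rule cconv_cube_scale)
  finally show ?thesis by simp
qed

text \<open>
  Division by the square of the eigenvalue gains four powers of the frequency over the divergence form of the cubic
  term, which costs one.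
\<close>

lemma norm_dft_N_N_le:
  assumes "\<kappa> \<in> freqs K" "lam \<kappa> \<noteq> 0"
  shows "norm (dft K (N_N K \<psi>) \<kappa>) / (lam \<kappa>)\<^sup>2 \<le>
     9 * (freq_size \<kappa> powr (- 3) * cconv_cube K (\<lambda>\<eta>. freq_size \<eta> * amp K \<psi> \<eta>) \<kappa>)
     + 2 * (freq_size \<kappa> powr (- 2) * amp K \<psi> \<kappa>)"
proof -
  let ?J = "freq_size \<kappa>"
  let ?T = "cconv_cube K (\<lambda>\<eta>. freq_size \<eta> * amp K \<psi> \<eta>) \<kappa>"
  let ?F = "\<lambda>i. dft K (\<lambda>q. (norm (grad_N K \<psi> q))\<^sup>2 * D_N K i \<psi> q) \<kappa>"
  have T: "0 \<le> ?T" by (intro cconv_cube_nonneg) auto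
  have lam: "(2 * pi)\<^sup>2 * ?J\<^sup>2 \<le> lam \<kappa>" using freq_size_eq_or_lam_ge [of \<kappa>] assms(2) by auto
  have pos: "0 < (2 * pi)\<^sup>2 * ?J\<^sup>2" by simp
  have lam_pos: "0 < lam \<kappa>" using pos lam by (rule less_le_trans)
  have "norm (dft K (N_N K \<psi>) \<kappa>) \<le>
      (\<Sum>i\<in>UNIV. norm (2 * of_real pi * \<i> * of_int (wave_comp i \<kappa>) * ?F i)) + norm (2 * of_real (lam \<kappa>) * dft K \<psi> \<kappa>)"
    unfolding dft_N_N [OF assms(1)]
    by (rule order_trans [OF norm_triangle_ineq4]) (simp only: norm_minus_cancel, intro add_right_mono norm_sum)
  also have "\<dots> \<le> (\<Sum>i\<in>(UNIV :: 3 set). 2 * pi * ?J * (3 * (2 * pi) ^ 3 * ?T)) + 2 * lam \<kappa> * amp K \<psi> \<kappa>"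
  proof (intro add_mono sum_mono)
    fix i
    have "norm (2 * of_real pi * \<i> * of_int (wave_comp i \<kappa>) * ?F i) = 2 * pi * \<bar>of_int (wave_comp i \<kappa>)\<bar> * norm (?F i)"
      by (simp add: norm_mult)
    also have "\<dots> \<le> 2 * pi * ?J * (3 * (2 * pi) ^ 3 * ?T)"
      using wave_comp_le_freq_size norm_dft_cubic_le [OF assms(1), of \<psi> i] by (intro mult_mono mult_left_mono) auto
    finally show "norm (2 * of_real pi * \<i> * of_int (wave_comp i \<kappa>) * ?F i) \<le> 2 * pi * ?J * (3 * (2 * pi) ^ 3 * ?T)" .
  qed (simp add: norm_mult)
  finally have "norm (dft K (N_N K \<psi>) \<kappa>) \<le> 9 * (2 * pi) ^ 4 * ?J * ?T + 2 * lam \<kappa> * amp K \<psi> \<kappa>"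
    by (simp add: power4_eq_xxxx power3_eq_cube mult_ac)
  then have "norm (dft K (N_N K \<psi>) \<kappa>) / (lam \<kappa>)\<^sup>2 \<le>
      (9 * (2 * pi) ^ 4 * ?J * ?T) / (lam \<kappa>)\<^sup>2 + 2 * amp K \<psi> \<kappa> / lam \<kappa>"
    using assms(2) by (simp add: divide_simps power2_eq_square split: if_splits) (simp add: algebra_simps)
  also have "\<dots> \<le> (9 * (2 * pi) ^ 4 * ?J * ?T) / ((2 * pi)\<^sup>2 * ?J\<^sup>2)\<^sup>2 + 2 * amp K \<psi> \<kappa> / (1 * ?J\<^sup>2)"
  proof (intro add_mono divide_left_mono)
    show "((2 * pi)\<^sup>2 * ?J\<^sup>2)\<^sup>2 \<le> (lam \<kappa>)\<^sup>2" using lam by (intro power_mono) auto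
    have "1 * ?J\<^sup>2 \<le> (2 * pi)\<^sup>2 * ?J\<^sup>2"
      using pi_ge_two by (intro mult_right_mono one_le_power) auto
    then show "1 * ?J\<^sup>2 \<le> lam \<kappa>" using lam by linarith
    show "0 < (lam \<kappa>)\<^sup>2 * ((2 * pi)\<^sup>2 * ?J\<^sup>2)\<^sup>2" using pos lam_pos by simp
    show "0 < lam \<kappa> * (1 * ?J\<^sup>2)" using lam_pos by simp
  qed (use T in auto)
  also have "(9 * (2 * pi) ^ 4 * ?J * ?T) / ((2 * pi)\<^sup>2 * ?J\<^sup>2)\<^sup>2 = 9 * (?J powr (- 3) * ?T)"
    by (simp add: powr_minus field_simps power_numeral_reduce)
  also have "2 * amp K \<psi> \<kappa> / (1 * ?J\<^sup>2) = 2 * (?J powr (- 2) * amp K \<psi> \<kappa>)"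
    by (simp add: powr_minus field_simps)
  finally show ?thesis .
qed

text \<open>
  A bound for the forcing that is uniform in time, even though it is taken mode by mode, passes to the solution without
  any loss. Since \<open>E1_N\<close> is at least 1, the scalar factor in front of the nonlinearity is at most \<open>\<bar>r\<bar>\<close>.
\<close>

lemma uniform_mode_bound:
  assumes adm: "admissible a M0 M1 K dt \<phi> r" and a: "0 < a" and k: "\<kappa> \<in> freqs K" and Y: "0 \<le> Y" and R: "0 \<le> R"
    and r: "\<And>n. 0 \<le> n \<Longrightarrow> \<bar>r n\<bar> \<le> R"
    and forcing: "\<And>n. 0 \<le> n \<Longrightarrow>
      9 * (freq_size \<kappa> powr (- 3) * cconv_cube K (\<lambda>\<eta>. freq_size \<eta> * amp K (extrapolation \<phi> n) \<eta>) \<kappa>)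
      + 2 * (freq_size \<kappa> powr (- 2) * amp K (extrapolation \<phi> n) \<kappa>) \<le> Y"
    and n: "- 1 \<le> n"
  shows "amp K (\<phi> n) \<kappa> \<le> 5 * (amp K (\<phi> 0) \<kappa> + (amp K (\<phi> (- 1)) \<kappa> + R * Y))"
proof -
  let ?b = "a + (lam \<kappa>)\<^sup>2"
  define z where "z = dt * lam \<kappa> * ?b"
  \<comment> \<open>The Laplacian in front of the nonlinearity annihilates the zero mode, where \<open>z = 0\<close>.\<close>
  define f where "f m = (if lam \<kappa> = 0 then 0 else - of_real (sav_factor K \<phi> r (int m)) *
      dft K (N_N K (extrapolation \<phi> (int m))) \<kappa> / of_real ?b)" for m
  define u where "u m = dft K (\<phi> (int m - 1)) \<kappa>" for m
  have "norm (u m) \<le> 5 * (norm (u 0) + norm (u 1) + R * Y)" for m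
  proof (rule bdf2_mode_bound [where f = f and z = z])
    fix m
    have "sav_step K a dt \<phi> r (int m)" using adm by (rule admissible_step) simp
    from sav_mode_recursion [OF this k] adm a
    show "(3 / 2 + of_real z) * u (m + 2) = 2 * u (m + 1) - 1 / 2 * u m + of_real z * f m"
      by (cases "lam \<kappa> = 0") (simp_all add: u_def z_def f_def admissible_def add.commute)
    show "norm (f m) \<le> R * Y"
    proof (cases "lam \<kappa> = 0")
      case True then show ?thesis using R Y by (simp add: f_def)
    next
      case False
      let ?\<psi> = "extrapolation \<phi> (int m)"
      have s: "\<bar>sav_factor K \<phi> r (int m)\<bar> \<le> R"
      proof -
        have "\<bar>sav_factor K \<phi> r (int m)\<bar> \<le> \<bar>r (int m + 1)\<bar> / 1"
          unfolding sav_factor_def abs_divide using E1_N_ge_1 [of K ?\<psi>] by (intro divide_left_mono) auto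
        then show ?thesis using r [of "int m + 1"] by simp
      qed
      have "norm (f m) = \<bar>sav_factor K \<phi> r (int m)\<bar> * (norm (dft K (N_N K ?\<psi>) \<kappa>) / ?b)"
        using False a norm_of_real [of ?b, where 'a = complex] by (simp add: f_def norm_mult norm_divide del: of_real_add)
      also have "\<dots> \<le> R * (norm (dft K (N_N K ?\<psi>) \<kappa>) / (lam \<kappa>)\<^sup>2)"
        using s R a False by (intro mult_mono divide_left_mono) (auto intro!: mult_pos_pos add_pos_nonneg)
      also have "\<dots> \<le> R * Y"
        using norm_dft_N_N_le [OF k False, of ?\<psi>] forcing [of "int m"] R by (intro mult_left_mono) auto
      finally show ?thesis .
    qed
  qed (use adm a R Y in \<open>auto simp: z_def admissible_def\<close>)
  from this [of "nat (n + 1)"] n show ?thesis by (simp add: u_def add_ac)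
qed

section \<open>The uniform third-order bound\<close>

theorem theorem3p8:
  fixes \<epsilon> a M0 M1 :: real
  assumes "0 < \<epsilon>" "\<epsilon> < 1" "a = 1 - \<epsilon>"
  shows "\<exists>Q3. \<forall>K dt \<phi> r.
    0 < dt \<longrightarrow> sav_solution K a dt \<phi> r \<longrightarrow>
    sobolev_norm 3 (spectral_interp K (\<phi> 0)) \<le> M0 \<longrightarrow>
    sobolev_norm 3 (spectral_interp K (\<phi> (-1))) \<le> M1 \<longrightarrow>
    (\<forall>m\<ge>1. sobolev_norm 3 (spectral_interp K (\<phi> m)) \<le> Q3)"
proof -
  have a: "0 < a" "a \<le> 1" using assms by auto
  obtain B where B: "0 \<le> B" and all: "\<And>K dt \<phi> r n. admissible a M0 M1 K dt \<phi> r \<longrightarrow> - 1 \<le> n \<longrightarrow>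
      wsum K 4 (amp K (\<phi> n)) \<le> B \<and> (0 \<le> n \<longrightarrow> \<bar>r n\<bar> \<le> B)"
    using uniform_H2_bound [OF a, of M0 M1] by blast
  have H2: "wsum K 4 (amp K (\<phi> n)) \<le> B" if "admissible a M0 M1 K dt \<phi> r" "- 1 \<le> n" for K dt \<phi> r n
    using all [of K dt \<phi> r n] that by simp
  have r: "\<bar>r n\<bar> \<le> B" if "admissible a M0 M1 K dt \<phi> r" "0 \<le> n" for K dt \<phi> r n
    using all [of K dt \<phi> r n] that by simp
  let ?L = lattice_const
  define \<tau> where "\<tau> = 3 * sqrt (2 * ?L * (10 * B) ^ 3)"
  define c where "c = B * (9 * \<tau> + 2 * sqrt (10 * B))"
  have \<tau>: "0 \<le> \<tau>" using B lattice_const(1) by (simp add: \<tau>_def)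
  have c: "0 \<le> c" using B \<tau> by (simp add: c_def)
  define W where "W = 50 * M0\<^sup>2 + 100 * M1\<^sup>2 + 100 * c\<^sup>2 * ?L"
  define X where "X = 162 * (16 * ?L\<^sup>2 * (9 * W) ^ 3) + 72 * W"
  define Z where "Z = 50 * M0\<^sup>2 + 100 * M1\<^sup>2 + 100 * B\<^sup>2 * X"
  have main: "sobolev_norm 3 (spectral_interp K (\<phi> m)) \<le> sqrt (64 * (2 * pi) ^ 6 * Z)"
    if adm: "admissible a M0 M1 K dt \<phi> r" and m: "- 1 \<le> m" for K dt \<phi> r m
  proof -
    let ?J = freq_size
    let ?u0 = "amp K (\<phi> 0)" and ?u1 = "amp K (\<phi> (- 1))"
    let ?\<psi> = "\<lambda>n. amp K (extrapolation \<phi> n)"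
    let ?q = "\<lambda>n \<eta>. ?J \<eta> * ?\<psi> n \<eta>"
    have u0: "wsum K 6 ?u0 \<le> M0\<^sup>2" and u1: "wsum K 6 ?u1 \<le> M1\<^sup>2" using admissible_initial [OF adm] by auto
    have \<psi>: "?\<psi> n \<kappa> \<le> 2 * amp K (\<phi> n) \<kappa> + amp K (\<phi> (n - 1)) \<kappa>" for n \<kappa>
      unfolding dft_extrapolation using norm_triangle_ineq4 [of "2 * dft K (\<phi> n) \<kappa>"] by (simp add: norm_mult)
    have \<psi>4: "wsum K 4 (?\<psi> n) \<le> 10 * B" if "0 \<le> n" for n
    proof -
      have "wsum K 4 (?\<psi> n) \<le> wsum K 4 (\<lambda>\<kappa>. 2 * amp K (\<phi> n) \<kappa> + amp K (\<phi> (n - 1)) \<kappa>)"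
        by (rule wsum_mono) (use \<psi> in auto)
      also have "\<dots> \<le> 2 * (4 * wsum K 4 (amp K (\<phi> n))) + 2 * wsum K 4 (amp K (\<phi> (n - 1)))"
        using wsum_add_le [of K 4 "\<lambda>\<kappa>. 2 * amp K (\<phi> n) \<kappa>"] by (simp add: wsum_scale)
      finally show ?thesis using H2 [OF adm, of n] H2 [OF adm, of "n - 1"] that by simp
    qed
    \<comment> \<open>First bootstrap step: the second-order bound gives a forcing of size \<open>freq_size powr - 4\<close> in every mode.\<close>
    define U where "U \<kappa> = 5 * (?u0 \<kappa> + (?u1 \<kappa> + c * ?J \<kappa> powr (- 4)))" for \<kappa>
    have U0: "0 \<le> U \<kappa>" for \<kappa> using c by (simp add: U_def)
    have U: "amp K (\<phi> n) \<kappa> \<le> U \<kappa>" if "- 1 \<le> n" "\<kappa> \<in> freqs K" for n \<kappa>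
    proof -
      define Y where "Y = (9 * \<tau> + 2 * sqrt (10 * B)) * ?J \<kappa> powr (- 4)"
      have "amp K (\<phi> n) \<kappa> \<le> 5 * (?u0 \<kappa> + (?u1 \<kappa> + B * Y))"
      proof (rule uniform_mode_bound [OF adm a(1) \<open>\<kappa> \<in> freqs K\<close> _ B r [OF adm] _ \<open>- 1 \<le> n\<close>])
        show "0 \<le> Y" using \<tau> B by (simp add: Y_def)
        fix j :: int assume j: "0 \<le> j"
        have "wsum K 2 (?q j) \<le> 10 * B"
          using wsum_weight [of K 2 1 "?\<psi> j"] \<psi>4 [OF j] by simp
        then have "sqrt (2 * ?L * wsum K 2 (?q j) ^ 3) \<le> sqrt (2 * ?L * (10 * B) ^ 3)"
          using lattice_const(1) by (intro real_sqrt_le_mono mult_left_mono power_mono) auto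
        moreover have "?J \<kappa> * cconv_cube K (?q j) \<kappa> \<le> 3 * sqrt (2 * ?L * wsum K 2 (?q j) ^ 3)"
          by (rule cconv_cube_sup_le) (use \<open>\<kappa> \<in> freqs K\<close> in auto)
        ultimately have "?J \<kappa> * cconv_cube K (?q j) \<kappa> \<le> \<tau>"
          unfolding \<tau>_def by linarith
        then have "?J \<kappa> powr (- 4) * (?J \<kappa> * cconv_cube K (?q j) \<kappa>) \<le> ?J \<kappa> powr (- 4) * \<tau>"
          by (intro mult_left_mono) auto
        also have "?J \<kappa> powr (- 4) * (?J \<kappa> * cconv_cube K (?q j) \<kappa>) = ?J \<kappa> powr (- 3) * cconv_cube K (?q j) \<kappa>"
          using powr_add [of "?J \<kappa>" "- 4" 1] by (simp add: mult.assoc [symmetric] del: powr_neg_numeral)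
        finally have 1: "?J \<kappa> powr (- 3) * cconv_cube K (?q j) \<kappa> \<le> ?J \<kappa> powr (- 4) * \<tau>" .
        have "?J \<kappa> powr 2 * ?\<psi> j \<kappa> \<le> sqrt (10 * B)"
        proof (rule real_le_rsqrt)
          have "(?J \<kappa> powr 2 * ?\<psi> j \<kappa>)\<^sup>2 = ?J \<kappa> powr 4 * (?\<psi> j \<kappa>)\<^sup>2"
            by (simp add: power_mult_distrib flip: power_mult)
          also have "\<dots> \<le> wsum K 4 (?\<psi> j)"
            unfolding wsum_def by (rule member_le_sum) (use \<open>\<kappa> \<in> freqs K\<close> in auto)
          finally show "(?J \<kappa> powr 2 * ?\<psi> j \<kappa>)\<^sup>2 \<le> 10 * B" using \<psi>4 [OF j] by linarith
        qed
        then have "?J \<kappa> powr (- 4) * (?J \<kappa> powr 2 * ?\<psi> j \<kappa>) \<le> ?J \<kappa> powr (- 4) * sqrt (10 * B)"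
          by (intro mult_left_mono) auto
        also have "?J \<kappa> powr (- 4) * (?J \<kappa> powr 2 * ?\<psi> j \<kappa>) = ?J \<kappa> powr (- 2) * ?\<psi> j \<kappa>"
          using powr_add [of "?J \<kappa>" "- 4" 2] by (simp add: mult.assoc [symmetric] del: powr_numeral powr_neg_numeral)
        finally have 2: "?J \<kappa> powr (- 2) * ?\<psi> j \<kappa> \<le> ?J \<kappa> powr (- 4) * sqrt (10 * B)" .
        show "9 * (?J \<kappa> powr (- 3) * cconv_cube K (?q j) \<kappa>) + 2 * (?J \<kappa> powr (- 2) * ?\<psi> j \<kappa>) \<le> Y"
          using 1 2 unfolding Y_def by (simp add: algebra_simps del: powr_neg_numeral)
      qed
      then show ?thesis by (simp add: U_def Y_def c_def mult.assoc del: powr_neg_numeral)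
    qed
    have UW: "wsum K (9 / 2) U \<le> W"
    proof -
      \<comment> \<open>Here \<open>9 / 2 - 8 = - 7 / 2\<close> meets the exponent of the lattice constant.\<close>
      have J4: "wsum K (9 / 2) (\<lambda>\<kappa>. c * ?J \<kappa> powr (- 4)) \<le> c\<^sup>2 * ?L"
      proof -
        have "wsum K (9 / 2) (\<lambda>\<kappa>. c * ?J \<kappa> powr (- 4)) = c\<^sup>2 * wsum K (9 / 2) (\<lambda>\<kappa>. ?J \<kappa> powr (- 4) * 1)"
          by (simp add: wsum_scale del: powr_neg_numeral)
        also have "wsum K (9 / 2) (\<lambda>\<kappa>. ?J \<kappa> powr (- 4) * 1) = (\<Sum>\<kappa>\<in>freqs K. ?J \<kappa> powr (- 7 / 2))"
          unfolding wsum_weight by (simp add: wsum_def)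
        finally show ?thesis using lattice_const(2) [of K] by (simp add: mult_left_mono)
      qed
      have "wsum K (9 / 2) U = 25 * wsum K (9 / 2) (\<lambda>\<kappa>. ?u0 \<kappa> + (?u1 \<kappa> + c * ?J \<kappa> powr (- 4)))"
        unfolding U_def wsum_scale by simp
      also have "\<dots> \<le> 25 * (2 * wsum K (9 / 2) ?u0 + 2 * (2 * wsum K (9 / 2) ?u1 + 2 * wsum K (9 / 2) (\<lambda>\<kappa>. c * ?J \<kappa> powr (- 4))))"
        by (intro mult_left_mono order_trans [OF wsum_add_le] add_left_mono wsum_add_le) auto
      also have "\<dots> \<le> 25 * (2 * M0\<^sup>2 + 2 * (2 * M1\<^sup>2 + 2 * (c\<^sup>2 * ?L)))"
      proof -
        have "wsum K (9 / 2) ?u0 \<le> M0\<^sup>2" "wsum K (9 / 2) ?u1 \<le> M1\<^sup>2"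
          by (rule order_trans [OF wsum_mono u0]; simp) (rule order_trans [OF wsum_mono u1]; simp)
        with J4 show ?thesis by (intro mult_left_mono add_mono) auto
      qed
      finally show ?thesis by (simp add: W_def)
    qed
    \<comment> \<open>Second bootstrap step: \<open>V\<close> majorises the gradient of the extrapolated solution at all times at once.\<close>
    define V where "V \<kappa> = 3 * (?J \<kappa> powr 1 * U \<kappa>)" for \<kappa>
    have V0: "0 \<le> V \<kappa>" for \<kappa> using U0 by (simp add: V_def)
    have VW: "wsum K (5 / 2) V \<le> 9 * W"
      unfolding V_def wsum_scale wsum_weight using UW by simp
    have \<psi>U: "?\<psi> n \<kappa> \<le> 3 * U \<kappa>" if "0 \<le> n" "\<kappa> \<in> freqs K" for n \<kappa>
      using \<psi> [of n \<kappa>] U [of n \<kappa>] U [of "n - 1" \<kappa>] that by simp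
    define Y where "Y \<kappa> = 9 * (?J \<kappa> powr (- 3) * cconv_cube K V \<kappa>) + 6 * (?J \<kappa> powr (- 2) * U \<kappa>)" for \<kappa>
    have T0: "0 \<le> cconv_cube K V \<kappa>" for \<kappa> by (intro cconv_cube_nonneg V0)
    have Y0: "0 \<le> Y \<kappa>" for \<kappa> using T0 U0 by (simp add: Y_def)
    have fin: "amp K (\<phi> m) \<kappa> \<le> 5 * (?u0 \<kappa> + (?u1 \<kappa> + B * Y \<kappa>))" if k: "\<kappa> \<in> freqs K" for \<kappa>
    proof (rule uniform_mode_bound [OF adm a(1) k Y0 B r [OF adm] _ m])
      fix j :: int assume j: "0 \<le> j"
      have "?q j \<eta> \<le> V \<eta>" if "\<eta> \<in> freqs K" for \<eta>
        using mult_left_mono [OF \<psi>U [OF j that], of "?J \<eta>"] by (simp add: V_def mult.left_commute)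
      then have "cconv_cube K (?q j) \<kappa> \<le> cconv_cube K V \<kappa>" by (intro cconv_cube_mono) auto
      then have "?J \<kappa> powr (- 3) * cconv_cube K (?q j) \<kappa> \<le> ?J \<kappa> powr (- 3) * cconv_cube K V \<kappa>"
        by (intro mult_left_mono) auto
      moreover have "?J \<kappa> powr (- 2) * ?\<psi> j \<kappa> \<le> ?J \<kappa> powr (- 2) * (3 * U \<kappa>)"
        by (intro mult_left_mono \<psi>U j k) auto
      ultimately show "9 * (?J \<kappa> powr (- 3) * cconv_cube K (?q j) \<kappa>) + 2 * (?J \<kappa> powr (- 2) * ?\<psi> j \<kappa>) \<le> Y \<kappa>"
        unfolding Y_def by linarith
    qed
    have YX: "wsum K 6 Y \<le> X"
    proof -
      have "wsum K 6 Y \<le> 2 * (81 * wsum K 0 (cconv_cube K V)) + 2 * (36 * wsum K 2 U)"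
        unfolding Y_def by (rule order_trans [OF wsum_add_le]) (simp add: wsum_scale wsum_weight del: powr_neg_numeral)
      moreover have "wsum K 0 (cconv_cube K V) \<le> 16 * ?L\<^sup>2 * (9 * W) ^ 3"
        using VW
        by (intro order_trans [OF wsum_cconv_cube_le [OF V0]] mult_left_mono power_mono) auto
      moreover have "wsum K 2 U \<le> W"
        by (rule order_trans [OF wsum_mono UW]) (use U0 in auto)
      ultimately show ?thesis by (simp add: X_def)
    qed
    have "wsum K 6 (amp K (\<phi> m)) \<le> wsum K 6 (\<lambda>\<kappa>. 5 * (?u0 \<kappa> + (?u1 \<kappa> + B * Y \<kappa>)))"
      using fin by (intro wsum_mono) auto
    also have "\<dots> = 25 * wsum K 6 (\<lambda>\<kappa>. ?u0 \<kappa> + (?u1 \<kappa> + B * Y \<kappa>))"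
      unfolding wsum_scale by simp
    also have "\<dots> \<le> 25 * (2 * wsum K 6 ?u0 + 2 * (2 * wsum K 6 ?u1 + 2 * wsum K 6 (\<lambda>\<kappa>. B * Y \<kappa>)))"
      by (intro mult_left_mono order_trans [OF wsum_add_le] add_left_mono wsum_add_le) auto
    also have "\<dots> \<le> Z"
      using u0 u1 mult_left_mono [OF YX, of "B\<^sup>2"] by (simp add: Z_def wsum_scale)
    finally have "64 * (2 * pi) ^ 6 * wsum K 6 (amp K (\<phi> m)) \<le> 64 * (2 * pi) ^ 6 * Z"
      by (intro mult_left_mono) auto
    with sobolev_norm_le_wsum_6 [of K "\<phi> m"] show ?thesis by (intro real_le_rsqrt) linarith
  qed
  show ?thesis
    by (rule exI [of _ "sqrt (64 * (2 * pi) ^ 6 * Z)"]) (use main in \<open>auto simp: admissible_def\<close>)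
qed

end
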